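(* Consider the rank-based twisting $\Phi(a,b)=n-\operatorname{rank}(a)-\operatorname{rank}(b)+\operatorname{rank}(ab)$, restricted to each of the following submonoids of the partition monoid $\mathcal P_n$ ($n\geq1$). It is tight for the Brauer monoid $\mathcal B_n$, but loose for $\mathcal P_n$, the planar partition monoid $\mathscr P\mathcal P_n$, the partial Brauer monoid $\mathcal P\mathcal B_n$ and the Motzkin monoid $\mathcal M_n$ for $n\geq2$, and loose for the Temperley–Lieb monoid $\mathcal T\!\mathcal L_n$ for $n\geq3$.
   Context: Write $\mathbf n=\{1,\dots,n\}$, $\mathbf n'=\{1',\dots,n'\}$, $\mathbf n''=\{1'',\dots,n''\}$ (disjoint copies). $\mathcal P_n$ is the set of all set partitions of $\mathbf n\cup\mathbf n'$. A partition is identified with any graph on $\mathbf n\cup\mathbf n'$ whose connected components are its blocks. For $a,b\in\mathcal P_n$, let $a^\vee$ be $a$ with each $x'$ renamed $x''$ and $b^\wedge$ be $b$ with each $x$ renamed $x''$; the product graph $\Pi(a,b)$ on $\mathbf n\cup\mathbf n''\cup\mathbf n'$ has as edges the union of the edges of $a^\vee$ and $b^\wedge$. The product $ab\in\mathcal P_n$ is the partition in which $x,y\in\mathbf n\cup\mathbf n'$ are in the same block iff they are in the same connected component of $\Pi(a,b)$. A transversal of $a$ is a block meeting both $\mathbf n$ and $\mathbf n'$; $\operatorname{rank}(a)$ is the number of transversals of $a$. Submonoids: $\mathcal B_n$ = partitions all of whose blocks have size $2$; $\mathcal P\mathcal B_n$ = partitions all of whose blocks have size $\leq2$; $\mathscr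 P\mathcal P_n$ = planar partitions, i.e. those whose graph can be drawn without crossings, with vertices $1<\dots<n$ on an upper row and $1'<\dots<n'$ on a lower row, all edges inside the rectangle bounded by the vertices; $\mathcal T\!\mathcal L_n=\mathcal B_n\cap\mathscr P\mathcal P_n$; $\mathcal M_n=\mathcal P\mathcal B_n\cap\mathscr P\mathcal P_n$. A twisting of a monoid $S$ is a map $\Phi:S\times S\to\mathbb N=\{0,1,2,\dots\}$ with $\Phi(a,b)+\Phi(ab,c)=\Phi(a,bc)+\Phi(b,c)$ for all $a,b,c\in S$ (the rank-based map above is a twisting of $\mathcal P_n$, hence of any submonoid). A twisting of $S$ is tight if (a) for all $a,b\in S$ there is $a'\in S$ with $ab=a'b$ and $\Phi(a',b)=0$; and (b) for all $a,b\in S$ there is $b'\in S$ with $ab=ab'$ and $\Phi(a,b')=0$. Otherwise it is loose. *)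

theory Defs
  imports "HOL-Analysis.Analysis" "HOL-Algebra.Group" "HOL-Library.Disjoint_Sets"
begin

section \<open>Partitions and graphs\<close>

text \<open>The three constructors are the disjoint copies \<open>i\<close>, \<open>i''\<close>, \<open>i'\<close> of the positive integer \<open>i\<close>.
  The middle copies only occur in product graphs.\<close>

datatype vertex = Upper nat | Middle nat | Lower nat

definition vertices :: "nat \<Rightarrow> vertex set" where
  "vertices n = Upper ` {1..n} \<union> Lower ` {1..n}"

definition partitions :: "nat \<Rightarrow> vertex set set set" where
  "partitions n = {a. partition_on (vertices n) a}"

text \<open>A graph is given by its set of edges, an edge being a set of two vertices.\<close>

definition graph_on :: "'v set \<Rightarrow> 'v set set \<Rightarrow> bool" where
  "graph_on V E \<longleftrightarrow> (\<forall>e\<in>E. e \<subseteq> V \<and> card e = 2)"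

text \<open>The paths may leave \<open>V\<close>; this is used for product graphs, where \<open>V\<close> omits the middle row.\<close>

definition connection :: "'v set \<Rightarrow> 'v set set \<Rightarrow> 'v rel" where
  "connection V E = {(x, y) \<in> V \<times> V. (x, y) \<in> {(u, v). {u, v} \<in> E}\<^sup>*}"

definition components_on :: "'v set \<Rightarrow> 'v set set \<Rightarrow> 'v set set" where
  "components_on V E = V // connection V E"

definition graph_of_partition :: "nat \<Rightarrow> vertex set set \<Rightarrow> vertex set set \<Rightarrow> bool" where
  "graph_of_partition n a E \<longleftrightarrow> graph_on (vertices n) E \<and> components_on (vertices n) E = a"


section \<open>The partition monoid\<close>

text \<open>A partition is represented by the disjoint union of the complete graphs on its blocks;
  by the lemma \<open>product_any_graphs\<close> below the product does not depend on this choice.\<close>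

definition block_graph :: "vertex set set \<Rightarrow> vertex set set" where
  "block_graph a = {e. card e = 2 \<and> (\<exists>B\<in>a. e \<subseteq> B)}"

fun lower_to_middle :: "vertex \<Rightarrow> vertex" where
  "lower_to_middle (Lower i) = Middle i"
| "lower_to_middle (Upper i) = Upper i"
| "lower_to_middle (Middle i) = Middle i"

fun upper_to_middle :: "vertex \<Rightarrow> vertex" where
  "upper_to_middle (Upper i) = Middle i"
| "upper_to_middle (Lower i) = Lower i"
| "upper_to_middle (Middle i) = Middle i"

definition product_graph :: "vertex set set \<Rightarrow> vertex set set \<Rightarrow> vertex set set" where
  "product_graph E F = (image lower_to_middle) ` E \<union> (image upper_to_middle) ` F"

definition partition_product :: "nat \<Rightarrow> vertex set set \<Rightarrow> vertex set set \<Rightarrow> vertex set set" where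
  "partition_product n a b =
     components_on (vertices n) (product_graph (block_graph a) (block_graph b))"

definition partition_monoid :: "nat \<Rightarrow> vertex set set monoid" where
  "partition_monoid n =
     \<lparr>carrier = partitions n,
      monoid.mult = partition_product n,
      one = {{Upper i, Lower i} | i. i \<in> {1..n}}\<rparr>"

definition transversals :: "vertex set set \<Rightarrow> vertex set set" where
  "transversals a = {B \<in> a. B \<inter> range Upper \<noteq> {} \<and> B \<inter> range Lower \<noteq> {}}"

definition partition_rank :: "vertex set set \<Rightarrow> nat" where
  "partition_rank a = card (transversals a)"


section \<open>Planarity\<close>

text \<open>The value at middle vertices is irrelevant: only graphs on \<open>vertices n\<close> are drawn.\<close>

fun position :: "vertex \<Rightarrow> real ^ 2" where
  "position (Upper i) = vector [real i, 1]"
| "position (Middle i) = vector [real i, 1/2]"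
| "position (Lower i) = vector [real i, 0]"

text \<open>Edges are drawn as simple arcs in the closed rectangle bounded by the vertices; they pass
  through no vertices but their ends, and meet each other only in common ends.\<close>

definition crossing_free_drawing ::
    "nat \<Rightarrow> vertex set set \<Rightarrow> (vertex set \<Rightarrow> real \<Rightarrow> real ^ 2) \<Rightarrow> bool" where
  "crossing_free_drawing n E \<gamma> \<longleftrightarrow>
     (\<forall>e\<in>E. arc (\<gamma> e)
        \<and> {pathstart (\<gamma> e), pathfinish (\<gamma> e)} = position ` e
        \<and> path_image (\<gamma> e) \<subseteq> cbox (vector [1, 0]) (vector [real n, 1])
        \<and> path_image (\<gamma> e) \<inter> position ` vertices n = position ` e) \<and>
     (\<forall>e\<in>E. \<forall>f\<in>E. e \<noteq> f \<longrightarrow>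
        path_image (\<gamma> e) \<inter> path_image (\<gamma> f) \<subseteq> position ` (e \<inter> f))"

definition planar :: "nat \<Rightarrow> vertex set set \<Rightarrow> bool" where
  "planar n a \<longleftrightarrow> (\<exists>E \<gamma>. graph_of_partition n a E \<and> crossing_free_drawing n E \<gamma>)"


section \<open>Submonoids\<close>

definition brauer :: "nat \<Rightarrow> vertex set set set" where
  "brauer n = {a \<in> partitions n. \<forall>B\<in>a. card B = 2}"

definition partial_brauer :: "nat \<Rightarrow> vertex set set set" where
  "partial_brauer n = {a \<in> partitions n. \<forall>B\<in>a. card B \<le> 2}"

definition planar_partitions :: "nat \<Rightarrow> vertex set set set" where
  "planar_partitions n = {a \<in> partitions n. planar n a}"

definition brauer_monoid :: "nat \<Rightarrow> vertex set set monoid" where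
  "brauer_monoid n = (partition_monoid n)\<lparr>carrier := brauer n\<rparr>"

definition partial_brauer_monoid :: "nat \<Rightarrow> vertex set set monoid" where
  "partial_brauer_monoid n = (partition_monoid n)\<lparr>carrier := partial_brauer n\<rparr>"

definition planar_partition_monoid :: "nat \<Rightarrow> vertex set set monoid" where
  "planar_partition_monoid n = (partition_monoid n)\<lparr>carrier := planar_partitions n\<rparr>"

definition temperley_lieb_monoid :: "nat \<Rightarrow> vertex set set monoid" where
  "temperley_lieb_monoid n =
     (partition_monoid n)\<lparr>carrier := brauer n \<inter> planar_partitions n\<rparr>"

definition motzkin_monoid :: "nat \<Rightarrow> vertex set set monoid" where
  "motzkin_monoid n =
     (partition_monoid n)\<lparr>carrier := partial_brauer n \<inter> planar_partitions n\<rparr>"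


section \<open>Twistings\<close>

text \<open>Twistings are integer-valued, with the values on \<open>S\<close> required to be natural numbers, so that
  the subtractions in the rank-based twisting are not truncated.\<close>

definition twisting :: "('a, 'm) monoid_scheme \<Rightarrow> ('a \<Rightarrow> 'a \<Rightarrow> int) \<Rightarrow> bool" where
  "twisting S \<Phi> \<longleftrightarrow>
     (\<forall>a\<in>carrier S. \<forall>b\<in>carrier S. \<Phi> a b \<in> \<nat>) \<and>
     (\<forall>a\<in>carrier S. \<forall>b\<in>carrier S. \<forall>c\<in>carrier S.
        \<Phi> a b + \<Phi> (a \<otimes>\<^bsub>S\<^esub> b) c = \<Phi> a (b \<otimes>\<^bsub>S\<^esub> c) + \<Phi> b c)"

definition tight_twisting :: "('a, 'm) monoid_scheme \<Rightarrow> ('a \<Rightarrow> 'a \<Rightarrow> int) \<Rightarrow> bool" where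
  "tight_twisting S \<Phi> \<longleftrightarrow> twisting S \<Phi> \<and>
     (\<forall>a\<in>carrier S. \<forall>b\<in>carrier S.
        \<exists>a'\<in>carrier S. a \<otimes>\<^bsub>S\<^esub> b = a' \<otimes>\<^bsub>S\<^esub> b \<and> \<Phi> a' b = 0) \<and>
     (\<forall>a\<in>carrier S. \<forall>b\<in>carrier S.
        \<exists>b'\<in>carrier S. a \<otimes>\<^bsub>S\<^esub> b = a \<otimes>\<^bsub>S\<^esub> b' \<and> \<Phi> a b' = 0)"

definition loose_twisting :: "('a, 'm) monoid_scheme \<Rightarrow> ('a \<Rightarrow> 'a \<Rightarrow> int) \<Rightarrow> bool" where
  "loose_twisting S \<Phi> \<longleftrightarrow> twisting S \<Phi> \<and> \<not> tight_twisting S \<Phi>"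

definition rank_twisting :: "nat \<Rightarrow> vertex set set \<Rightarrow> vertex set set \<Rightarrow> int" where
  "rank_twisting n a b =
     int n - int (partition_rank a) - int (partition_rank b)
       + int (partition_rank (a \<otimes>\<^bsub>partition_monoid n\<^esub> b))"


section \<open>Independence of the representing graphs\<close>

lemma adjacency_sym: "sym {(u, v). {u, v} \<in> E}"
  by (auto simp: sym_def insert_commute)

lemma equiv_connection: "equiv V (connection V E)"
proof (rule equivI)
  show "connection V E \<subseteq> V \<times> V" by (auto simp: connection_def)
  show "refl_on V (connection V E)" by (auto simp: refl_on_def connection_def)
  show "sym (connection V E)"
    using sym_rtrancl[OF adjacency_sym[of E]] by (auto simp: sym_def connection_def)
  show "trans (connection V E)" by (auto simp: trans_def connection_def)
qed

lemma rtrancl_adjacency_image: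
  assumes "(x, y) \<in> {(u, v). {u, v} \<in> E}\<^sup>*"
  shows "(f x, f y) \<in> {(u, v). {u, v} \<in> (image f) ` E}\<^sup>*"
  using assms
proof (induction rule: rtrancl_induct)
  case (step y z)
  then have "{f y, f z} \<in> (image f) ` E" by (auto intro!: image_eqI[of _ _ "{y, z}"])
  then show ?case using step.IH by (auto intro: rtrancl_into_rtrancl)
qed simp

lemma graph_subset_block_graph:
  assumes "graph_of_partition n a E"
  shows "E \<subseteq> block_graph a"
proof
  fix e assume e: "e \<in> E"
  with assms have "card e = 2" "e \<subseteq> vertices n"
    by (auto simp: graph_of_partition_def graph_on_def)
  then obtain x y where xy: "e = {x, y}" "card e = 2" "x \<in> vertices n" "y \<in> vertices n"
    by (metis card_2_iff insert_subset)
  define B where "B = connection (vertices n) E `` {x}"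
  have "B \<in> a"
    using assms xy unfolding B_def graph_of_partition_def components_on_def
    by (auto intro: quotientI)
  moreover have "e \<subseteq> B"
    using xy e by (auto simp: B_def connection_def)
  ultimately show "e \<in> block_graph a" using xy by (auto simp: block_graph_def)
qed

lemma block_graph_path:
  assumes "graph_of_partition n a E" "{x, y} \<in> block_graph a"
  shows "(x, y) \<in> {(u, v). {u, v} \<in> E}\<^sup>*"
proof -
  obtain B where "B \<in> vertices n // connection (vertices n) E" "x \<in> B" "y \<in> B"
    using assms by (auto simp: block_graph_def graph_of_partition_def components_on_def)
  then have "(x, y) \<in> connection (vertices n) E"
    using quotient_eq_iff[OF equiv_connection] by metis
  then show ?thesis by (simp add: connection_def)
qed

lemma image_block_graph_path:
  assumes "graph_of_partition n a E" "{u, v} \<in> (image f) ` block_graph a"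
  shows "(u, v) \<in> {(u, v). {u, v} \<in> (image f) ` E}\<^sup>*"
proof -
  obtain e where e: "e \<in> block_graph a" "{u, v} = f ` e" using assms(2) by auto
  then obtain p q where pq: "e = {p, q}" by (auto simp: block_graph_def card_2_iff)
  have "{q, p} \<in> block_graph a" using e(1) pq by (simp add: insert_commute)
  then have "(f p, f q) \<in> {(u, v). {u, v} \<in> (image f) ` E}\<^sup>*"
    and "(f q, f p) \<in> {(u, v). {u, v} \<in> (image f) ` E}\<^sup>*"
    using e(1) pq
    by (auto intro!: rtrancl_adjacency_image block_graph_path[OF assms(1)])
  moreover have "(u = f p \<and> v = f q) \<or> (u = f q \<and> v = f p)"
    using e(2) pq by (auto simp: doubleton_eq_iff)
  ultimately show ?thesis by auto
qed

lemma product_any_graphs: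
  assumes "graph_of_partition n a E" "graph_of_partition n b F"
  shows "components_on (vertices n) (product_graph E F) = partition_product n a b"
proof -
  let ?A = "\<lambda>E F. {(u, v). {u, v} \<in> product_graph E F}"
  let ?G = "block_graph a" and ?H = "block_graph b"
  have "?A E F \<subseteq> ?A ?G ?H"
    using graph_subset_block_graph[OF assms(1)] graph_subset_block_graph[OF assms(2)]
    unfolding product_graph_def by blast
  then have le: "(?A E F)\<^sup>* \<subseteq> (?A ?G ?H)\<^sup>*" by (rule rtrancl_mono)
  have "?A ?G ?H \<subseteq> (?A E F)\<^sup>*"
  proof clarify
    fix u v assume "{u, v} \<in> product_graph ?G ?H"
    then consider "{u, v} \<in> (image lower_to_middle) ` ?G" | "{u, v} \<in> (image upper_to_middle) ` ?H"
      unfolding product_graph_def by blast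
    then show "(u, v) \<in> (?A E F)\<^sup>*"
    proof cases
      case 1
      have "{(u, v). {u, v} \<in> (image lower_to_middle) ` E} \<subseteq> ?A E F"
        unfolding product_graph_def by blast
      from rtrancl_mono[OF this] image_block_graph_path[OF assms(1) 1] show ?thesis by blast
    next
      case 2
      have "{(u, v). {u, v} \<in> (image upper_to_middle) ` F} \<subseteq> ?A E F"
        unfolding product_graph_def by blast
      from rtrancl_mono[OF this] image_block_graph_path[OF assms(2) 2] show ?thesis by blast
    qed
  qed
  then have "(?A ?G ?H)\<^sup>* \<subseteq> (?A E F)\<^sup>*" by (rule rtrancl_subset_rtrancl)
  with le have "(?A E F)\<^sup>* = (?A ?G ?H)\<^sup>*" by blast
  then show ?thesis
    unfolding partition_product_def components_on_def connection_def by simp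
qed

end

(* A partition a of {1..n} u {1'..n'} is encoded by the relation of all pairs (u, l) of two-colourings
   of the rows for which u on the upper row and l on the lower row are constant on the blocks of a.
   The relation determines a, and the product of partitions is the composition of relations.

   Tightness for the Brauer monoid: the element a b b* has the same product with b as a, and over each
   hook {i, j} of b it has the hook {i', j'}; together they form a loop. Opening the loop by exchanging
   {i', j'} and an upper hook {x, y} for the transversals {x, i'}, {y, j'} raises the rank by 2 and
   leaves the product alone; after all loops are opened, the twisting vanishes.

   Looseness: for a product c = a b, the twisting vanishes at (a', b) iff
   rank a' = n - rank b + rank c, and c = a' b forces connections in a' that bound its rank. In the
   Temperley-Lieb monoid rank a' = n can only be reached by a permutation with an inversion, which
   is not planar by the Fashoda theorem. *)
theory Submission
  imports Defs
begin

text \<open>Paths in a product graph alternate between the two factors and are awkward to follow. A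
  colouring constant on components carries the same information: a colouring of the outer rows fits
  \<open>ab\<close> iff it extends over the middle row so as to fit both factors. Hence
  associativity is that of \<open>O\<close>, and the reflection of diagrams is the converse
  relation. Unions of blocks also form a vector space over the field with two elements, so
  inequalities between numbers of blocks are dimension counts. Two facts rest on such counts: the
  twisting is never negative, and products of Brauer elements are Brauer elements, as the witness a
  b b* requires. The loops are exactly enough: if \<open>b\<close> has h upper hooks, then rank b =
  n - 2h, while a b b* has the rank of \<open>ab\<close>. Opening h loops gives rank ab + n - rank
  b, the value at which the twisting vanishes. The condition on the right factor follows by
  reflection. For looseness it suffices to exhibit one pair that violates the condition on the left
  factor.\<close>

section \<open>Two-colourings of the rows and the blocks they determine\<close>

definition glue :: "(nat \<Rightarrow> bool) \<Rightarrow> (nat \<Rightarrow> bool) \<Rightarrow> vertex \<Rightarrow> bool" where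
  "glue u l v = (case v of Upper i \<Rightarrow> u i | Middle i \<Rightarrow> False | Lower i \<Rightarrow> l i)"

text \<open>The value at \<open>Middle\<close> is a dummy: blocks of elements of
  \<open>partitions n\<close> contain no middle vertices.\<close>

lemma glue_simps [simp]:
  "glue u l (Upper i) = u i" "glue u l (Lower i) = l i"
  by (simp_all add: glue_def)

definition colourings :: "vertex set set \<Rightarrow> ((nat \<Rightarrow> bool) \<times> (nat \<Rightarrow> bool)) set" where
  "colourings a = {(u, l). \<forall>B\<in>a. \<forall>x\<in>B. \<forall>y\<in>B. glue u l x = glue u l y}"

lemma colouringsD:
  "(u, l) \<in> colourings a \<Longrightarrow> B \<in> a \<Longrightarrow> x \<in> B \<Longrightarrow> y \<in> B \<Longrightarrow> glue u l x = glue u l y"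
  unfolding colourings_def by blast

lemma finite_vertices [simp]: "finite (vertices n)"
  by (simp add: vertices_def)

lemma in_vertices [simp]:
  "Upper i \<in> vertices n \<longleftrightarrow> i \<in> {1..n}" "Lower i \<in> vertices n \<longleftrightarrow> i \<in> {1..n}"
  "Middle i \<notin> vertices n"
  by (auto simp: vertices_def)

lemma block_subset: "a \<in> partitions n \<Longrightarrow> B \<in> a \<Longrightarrow> B \<subseteq> vertices n"
  by (auto simp: partitions_def partition_on_def)

lemma finite_partition: "a \<in> partitions n \<Longrightarrow> finite a"
  using finite_elements[of "vertices n" a] by (simp add: partitions_def)

lemma finite_block: "a \<in> partitions n \<Longrightarrow> B \<in> a \<Longrightarrow> finite B"
  by (meson block_subset finite_subset finite_vertices)

lemma block_eq: "a \<in> partitions n \<Longrightarrow> B \<in> a \<Longrightarrow> C \<in> a \<Longrightarrow> x \<in> B \<Longrightarrow> x \<in> C \<Longrightarrow> B = C"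
  unfolding partitions_def by (blast dest: partition_onD2 disjointD)

lemma block_nonempty: "a \<in> partitions n \<Longrightarrow> B \<in> a \<Longrightarrow> B \<noteq> {}"
  unfolding partitions_def by (auto dest: partition_onD3)

lemma block_exists:
  assumes "a \<in> partitions n" "x \<in> vertices n"
  obtains B where "B \<in> a" "x \<in> B"
  using assms by (auto simp: partitions_def partition_on_def)

lemma glue_indicator:
  "x \<in> vertices n \<Longrightarrow> glue (\<lambda>i. Upper i \<in> X) (\<lambda>i. Lower i \<in> X) x \<longleftrightarrow> x \<in> X"
  by (cases x) auto

lemma indicator_colouring:
  assumes "a \<in> partitions n" "\<And>B. B \<in> a \<Longrightarrow> B \<inter> X \<noteq> {} \<Longrightarrow> B \<subseteq> X"
  shows "(\<lambda>i. Upper i \<in> X, \<lambda>i. Lower i \<in> X) \<in> colourings a"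
  unfolding colourings_def
proof clarsimp
  fix B x y assume B: "B \<in> a" "x \<in> B" "y \<in> B"
  then have "x \<in> vertices n" "y \<in> vertices n" using block_subset[OF assms(1)] by auto
  moreover have "x \<in> X \<longleftrightarrow> y \<in> X" using assms(2)[OF B(1)] B by blast
  ultimately show "glue (\<lambda>i. Upper i \<in> X) (\<lambda>i. Lower i \<in> X) x = glue (\<lambda>i. Upper i \<in> X) (\<lambda>i. Lower i \<in> X) y"
    by (simp add: glue_indicator)
qed

lemma block_colouring:
  assumes "a \<in> partitions n" "B \<in> a"
  shows "(\<lambda>i. Upper i \<in> B, \<lambda>i. Lower i \<in> B) \<in> colourings a"
  using indicator_colouring[OF assms(1), of B] block_eq[OF assms(1) _ assms(2)] by blast

text \<open>The indicator of \<open>B\<close> is itself a colouring and separates \<open>B\<close>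
  from every other vertex, so a block can be read off from the colourings.\<close>

lemma block_eq_colourings:
  assumes "a \<in> partitions n" "B \<in> a" "x \<in> B"
  shows "B = {y \<in> vertices n. \<forall>(u, l)\<in>colourings a. glue u l x = glue u l y}"
proof
  show "B \<subseteq> {y \<in> vertices n. \<forall>(u, l)\<in>colourings a. glue u l x = glue u l y}"
    using assms(2,3) block_subset[OF assms(1,2)] colouringsD[OF _ assms(2)] by blast
  show "{y \<in> vertices n. \<forall>(u, l)\<in>colourings a. glue u l x = glue u l y} \<subseteq> B"
  proof clarify
    fix y assume "y \<in> vertices n" and *: "\<forall>(u, l)\<in>colourings a. glue u l x = glue u l y"
    moreover have "x \<in> vertices n" using assms block_subset by blast
    ultimately show "y \<in> B"
      using bspec[OF * block_colouring[OF assms(1,2)]] assms(3) by (simp add: glue_indicator[of _ n])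
  qed
qed

lemma same_blockI:
  assumes "a \<in> partitions n" "B \<in> a" "x \<in> B" "y \<in> vertices n"
    and "\<And>u l. (u, l) \<in> colourings a \<Longrightarrow> glue u l x = glue u l y"
  shows "y \<in> B"
  unfolding block_eq_colourings[OF assms(1-3)] using assms(4,5) by blast

text \<open>Identities between products are reduced by this to identities between relations.\<close>

lemma colourings_inject:
  assumes "a \<in> partitions n" "b \<in> partitions n" "colourings a = colourings b"
  shows "a = b"
proof -
  have "a \<subseteq> b" if ab: "a \<in> partitions n" "b \<in> partitions n" "colourings a = colourings b" for a b
  proof
    fix B assume B: "B \<in> a"
    then obtain x where x: "x \<in> B" using block_nonempty[OF ab(1)] by blast
    then obtain C where "C \<in> b" "x \<in> C"
      using block_exists[OF ab(2)] block_subset[OF ab(1) B] by blast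
    then have "B = C"
      using block_eq_colourings[OF ab(1) B x] block_eq_colourings[OF ab(2), of C x] ab(3) by simp
    with \<open>C \<in> b\<close> show "B \<in> b" by simp
  qed
  from this[OF assms] this[OF assms(2,1)] assms(3) show ?thesis by auto
qed

section \<open>Colourings of components and of products\<close>

lemma partitions_components_on: "components_on (vertices n) E \<in> partitions n"
  unfolding partitions_def components_on_def
  by (simp add: partition_on_quotient[OF equiv_connection])

lemma product_in_partitions [simp]: "partition_product n a b \<in> partitions n"
  by (simp add: partition_product_def partitions_components_on)

lemma rtrancl_adjacency_const:
  assumes "(x, y) \<in> {(u, v). {u, v} \<in> E}\<^sup>*" "\<And>u v. {u, v} \<in> E \<Longrightarrow> g u = g v"
  shows "g x = g y"
  using assms(1)
proof (induction rule: rtrancl_induct)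
  case (step y z)
  then show ?case using assms(2)[of y z] by simp
qed simp

text \<open>Edges of \<open>E\<close> may leave \<open>vertices n\<close>, as those of product
  graphs do. A condition on single edges would then not make sense for \<open>u\<close> and
  \<open>l\<close>, hence the formulation by connections.\<close>

lemma colourings_components_on_iff:
  "(u, l) \<in> colourings (components_on (vertices n) E) \<longleftrightarrow>
     (\<forall>(x, y)\<in>connection (vertices n) E. glue u l x = glue u l y)"
    (is "?L \<longleftrightarrow> ?R")
proof
  assume ?L
  show ?R
  proof clarify
    fix x y assume xy: "(x, y) \<in> connection (vertices n) E"
    then have x: "x \<in> vertices n" by (simp add: connection_def)
    show "glue u l x = glue u l y"
    proof (rule colouringsD[OF \<open>?L\<close>])
      show "connection (vertices n) E `` {x} \<in> components_on (vertices n) E"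
        using x by (simp add: components_on_def quotientI)
      show "x \<in> connection (vertices n) E `` {x}"
        using equiv_class_self[OF equiv_connection x] .
    qed (use xy in simp)
  qed
next
  assume R: ?R
  show ?L unfolding colourings_def components_on_def
  proof clarsimp
    fix B x y assume "B \<in> vertices n // connection (vertices n) E" "x \<in> B" "y \<in> B"
    then have "(x, y) \<in> connection (vertices n) E"
      using quotient_eq_iff[OF equiv_connection] by metis
    then show "glue u l x = glue u l y" using R by blast
  qed
qed

lemma colourings_components_on:
  assumes "graph_on (vertices n) E"
  shows "colourings (components_on (vertices n) E) =
    {(u, l). \<forall>e\<in>E. \<forall>x\<in>e. \<forall>y\<in>e. glue u l x = glue u l y}"
proof (intro equalityI subsetI; clarify)
  fix u l e x y
  assume "(u, l) \<in> colourings (components_on (vertices n) E)"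
    and e: "e \<in> E" "x \<in> e" "y \<in> e"
  then have *: "\<forall>(x, y)\<in>connection (vertices n) E. glue u l x = glue u l y"
    by (simp only: colourings_components_on_iff)
  show "glue u l x = glue u l y"
  proof (cases "x = y")
    case False
    have "card e = 2" and V: "e \<subseteq> vertices n" using e(1) assms by (auto simp: graph_on_def)
    then obtain p q where "e = {p, q}" by (meson card_2_iff)
    then have "e = {x, y}" using e False by auto
    then have "(x, y) \<in> connection (vertices n) E" using e V unfolding connection_def by blast
    then show ?thesis using * by blast
  qed simp
next
  fix u l
  assume *: "\<forall>e\<in>E. \<forall>x\<in>e. \<forall>y\<in>e. glue u l x = glue u l y"
  show "(u, l) \<in> colourings (components_on (vertices n) E)"
    unfolding colourings_components_on_iff
  proof clarify
    fix x y assume "(x, y) \<in> connection (vertices n) E"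
    then have "(x, y) \<in> {(u, v). {u, v} \<in> E}\<^sup>*" unfolding connection_def by blast
    then show "glue u l x = glue u l y"
    proof (rule rtrancl_adjacency_const[where g = "glue u l"])
      fix v w assume "{v, w} \<in> E"
      then show "glue u l v = glue u l w" using *[rule_format, of "{v, w}" v w] by simp
    qed
  qed
qed

text \<open>The intermediate element of the relational composition is a colouring of the middle row:
  both sides say that \<open>u\<close> and \<open>l\<close> extend to a colouring that is constant
  along every edge of the product graph.\<close>

lemma colourings_product:
  assumes "a \<in> partitions n" "b \<in> partitions n"
  shows "colourings (partition_product n a b) = colourings a O colourings b"
proof (intro equalityI subsetI; clarify)
  fix u l
  let ?G = "product_graph (block_graph a) (block_graph b)"
  let ?A = "{(u, v). {u, v} \<in> ?G}"
  {
    assume *: "(u, l) \<in> colourings (partition_product n a b)"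
    \<comment> \<open>The extension to the middle row: a vertex is coloured iff it can be reached
      from a coloured outer vertex. This is constant on components and agrees with \<open>u\<close>
      and \<open>l\<close> on the outer rows, since these are already constant on the blocks of the
      product.\<close>
    define g where "g v \<longleftrightarrow> (\<exists>w\<in>vertices n. glue u l w \<and> (w, v) \<in> ?A\<^sup>*)" for v
    have conn: "g x = g y" if "{x, y} \<in> ?G" for x y
    proof -
      have "(x, y) \<in> ?A" "(y, x) \<in> ?A" using that by (auto simp: insert_commute)
      then show ?thesis unfolding g_def by (meson rtrancl.rtrancl_into_rtrancl)
    qed
    have g: "g v = glue u l v" if "v \<in> vertices n" for v
    proof
      assume "g v"
      then show "glue u l v"
        using * that unfolding partition_product_def colourings_components_on_iff g_def
          connection_def by blast
    next
      assume "glue u l v"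
      then show "g v" using that unfolding g_def by blast
    qed
    have "(u, \<lambda>i. g (Middle i)) \<in> colourings a"
      unfolding colourings_def
    proof clarify
      fix B x y assume B: "B \<in> a" "x \<in> B" "y \<in> B"
      have *: "glue u (\<lambda>i. g (Middle i)) v = g (lower_to_middle v)" if "v \<in> B" for v
        using block_subset[OF assms(1) B(1)] that g[of v] by (cases v) auto
      show "glue u (\<lambda>i. g (Middle i)) x = glue u (\<lambda>i. g (Middle i)) y"
      proof (cases "x = y")
        case False
        then have "{x, y} \<in> block_graph a" using B by (auto simp: block_graph_def)
        then have "image lower_to_middle {x, y} \<in> ?G" unfolding product_graph_def by blast
        then have "g (lower_to_middle x) = g (lower_to_middle y)" by (intro conn) simp
        then show ?thesis using * B by simp
      qed simp
    qed
    moreover have "(\<lambda>i. g (Middle i), l) \<in> colourings b"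
      unfolding colourings_def
    proof clarify
      fix B x y assume B: "B \<in> b" "x \<in> B" "y \<in> B"
      have *: "glue (\<lambda>i. g (Middle i)) l v = g (upper_to_middle v)" if "v \<in> B" for v
        using block_subset[OF assms(2) B(1)] that g[of v] by (cases v) auto
      show "glue (\<lambda>i. g (Middle i)) l x = glue (\<lambda>i. g (Middle i)) l y"
      proof (cases "x = y")
        case False
        then have "{x, y} \<in> block_graph b" using B by (auto simp: block_graph_def)
        then have "image upper_to_middle {x, y} \<in> ?G" unfolding product_graph_def by blast
        then have "g (upper_to_middle x) = g (upper_to_middle y)" by (intro conn) simp
        then show ?thesis using * B by simp
      qed simp
    qed
    ultimately show "(u, l) \<in> colourings a O colourings b" by blast
  }
  {
    fix m assume um: "(u, m) \<in> colourings a" and ml: "(m, l) \<in> colourings b"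
    define g where "g v = (case v of Upper i \<Rightarrow> u i | Middle i \<Rightarrow> m i | Lower i \<Rightarrow> l i)" for v
    have conn: "g x = g y" if "{x, y} \<in> ?G" for x y
    proof -
      from that consider
        e where "e \<in> block_graph a" "{x, y} = lower_to_middle ` e" |
        e where "e \<in> block_graph b" "{x, y} = upper_to_middle ` e"
        unfolding product_graph_def by blast
      then show ?thesis
      proof cases
        case 1
        obtain B p q where B: "B \<in> a" "p \<in> B" "q \<in> B" "x = lower_to_middle p" "y = lower_to_middle q"
          using 1 unfolding block_graph_def by blast
        moreover have "g (lower_to_middle v) = glue u m v" if "v \<in> B" for v
          using block_subset[OF assms(1) B(1)] that by (cases v) (auto simp: g_def)
        ultimately show ?thesis using colouringsD[OF um B(1-3)] by simp
      next
        case 2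
        obtain B p q where B: "B \<in> b" "p \<in> B" "q \<in> B" "x = upper_to_middle p" "y = upper_to_middle q"
          using 2 unfolding block_graph_def by blast
        moreover have "g (upper_to_middle v) = glue m l v" if "v \<in> B" for v
          using block_subset[OF assms(2) B(1)] that by (cases v) (auto simp: g_def)
        ultimately show ?thesis using colouringsD[OF ml B(1-3)] by simp
      qed
    qed
    have g: "g v = glue u l v" if "v \<in> vertices n" for v
      using that by (cases v) (auto simp: g_def)
    show "(u, l) \<in> colourings (partition_product n a b)"
      unfolding partition_product_def colourings_components_on_iff
    proof clarify
      fix x y assume "(x, y) \<in> connection (vertices n) ?G"
      then show "glue u l x = glue u l y"
        using rtrancl_adjacency_const[of x y ?G g] conn g by (auto simp: connection_def)
    qed
  }
qed

lemma product_assoc: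
  assumes "a \<in> partitions n" "b \<in> partitions n" "c \<in> partitions n"
  shows "partition_product n (partition_product n a b) c =
    partition_product n a (partition_product n b c)"
  by (rule colourings_inject[of _ n]) (simp_all only: assms product_in_partitions colourings_product O_assoc)

section \<open>Counting blocks through unions of blocks\<close>

lemma card_Union_Pow:
  assumes "disjoint P" "{} \<notin> P" "finite P"
  shows "card (Union ` Pow P) = 2 ^ card P"
proof -
  have "inj_on Union (Pow P)"
  proof (rule inj_on_inverseI)
    fix A assume A: "A \<in> Pow P"
    have "B \<in> A" if B: "B \<in> P" "B \<subseteq> \<Union>A" for B
    proof -
      obtain x where x: "x \<in> B" using B(1) assms(2) by (cases "B = {}") auto
      then obtain C where "C \<in> A" "x \<in> C" using B(2) by blast
      then show ?thesis using A B(1) x disjointD[OF assms(1), of B C] by blast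
    qed
    then show "{B \<in> P. B \<subseteq> \<Union>A} = A" using A by blast
  qed
  then show ?thesis using assms(3) by (simp add: card_image card_Pow)
qed

lemma Union_Pow_iff:
  assumes "partition_on V P"
  shows "X \<in> Union ` Pow P \<longleftrightarrow> X \<subseteq> V \<and> (\<forall>B\<in>P. B \<inter> X \<noteq> {} \<longrightarrow> B \<subseteq> X)"
proof
  assume "X \<in> Union ` Pow P"
  then obtain A where A: "A \<subseteq> P" "X = \<Union>A" by auto
  have "B \<subseteq> X" if "B \<in> P" "B \<inter> X \<noteq> {}" for B
    using that A partition_onD2[OF assms] unfolding disjoint_def by blast
  then show "X \<subseteq> V \<and> (\<forall>B\<in>P. B \<inter> X \<noteq> {} \<longrightarrow> B \<subseteq> X)"
    using A partition_onD1[OF assms] by blast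
next
  assume *: "X \<subseteq> V \<and> (\<forall>B\<in>P. B \<inter> X \<noteq> {} \<longrightarrow> B \<subseteq> X)"
  have "X = \<Union>{B \<in> P. B \<subseteq> X}"
    using * partition_onD1[OF assms] by blast
  then show "X \<in> Union ` Pow P" by blast
qed

text \<open>The unions of blocks of \<open>P\<close> form a subgroup of order \<open>2 ^ card P\<close> of the power set of \<open>V\<close>
  under symmetric difference, and \<open>|G| |H| \<le> |V| |G \<inter> H|\<close> for subgroups.\<close>

lemma card_partitions_le:
  assumes V: "finite V" and P: "partition_on V P" and Q: "partition_on V Q" and J: "finite J"
    and PQ: "Union ` Pow P \<inter> Union ` Pow Q \<subseteq> Union ` Pow J"
  shows "card P + card Q \<le> card V + card J"
proof -
  let ?P = "Union ` Pow P" and ?Q = "Union ` Pow Q" and ?J = "Union ` Pow J"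
  define f :: "'a set \<times> 'a set \<Rightarrow> 'a set" where "f = (\<lambda>(X, Y). (X - Y) \<union> (Y - X))"
  have fin: "finite P" "finite Q" using finite_elements V P Q by auto
  have sd: "f (X, Y) \<in> Union ` Pow R" if "partition_on V R" "X \<in> Union ` Pow R" "Y \<in> Union ` Pow R" for X Y R
  proof -
    have X: "X \<subseteq> V" "\<And>B. B \<in> R \<Longrightarrow> B \<inter> X = {} \<or> B \<subseteq> X"
      and Y: "Y \<subseteq> V" "\<And>B. B \<in> R \<Longrightarrow> B \<inter> Y = {} \<or> B \<subseteq> Y"
      using that(2,3) unfolding Union_Pow_iff[OF that(1)] by blast+
    have "B \<subseteq> f (X, Y)" if B: "B \<in> R" and "B \<inter> f (X, Y) \<noteq> {}" for B
      using X(2)[OF B] Y(2)[OF B] that(2) by (auto simp: f_def)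
    moreover have "f (X, Y) \<subseteq> V" using X(1) Y(1) by (auto simp: f_def)
    ultimately show ?thesis unfolding Union_Pow_iff[OF that(1)] by blast
  qed
  \<comment> \<open>With one point (X, Y) of the fibre fixed, a point (A, B) is sent to X + A = Y +
    B, which lies in both subgroups. This value determines A, and then \<open>Z\<close> determines
    B.\<close>
  have fib: "card {p \<in> ?P \<times> ?Q. f p = Z} \<le> card ?J" for Z
  proof (cases "{p \<in> ?P \<times> ?Q. f p = Z} = {}")
    case False
    then obtain X Y where XY: "X \<in> ?P" "Y \<in> ?Q" "f (X, Y) = Z" by auto
    show ?thesis
    proof (rule card_inj_on_le)
      show "inj_on (\<lambda>p. f (X, fst p)) {p \<in> ?P \<times> ?Q. f p = Z}"
      proof (rule inj_onI)
        fix p q assume "p \<in> {p \<in> ?P \<times> ?Q. f p = Z}" "q \<in> {p \<in> ?P \<times> ?Q. f p = Z}"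
          and "f (X, fst p) = f (X, fst q)"
        moreover obtain A B A' B' where "p = (A, B)" "q = (A', B')" by (metis surj_pair)
        ultimately have "f (A, B) = f (A', B')" "f (X, A) = f (X, A')" "p = (A, B)" "q = (A', B')"
          by auto
        then show "p = q" unfolding f_def by auto
      qed
      show "(\<lambda>p. f (X, fst p)) ` {p \<in> ?P \<times> ?Q. f p = Z} \<subseteq> ?J"
      proof (rule image_subsetI)
        fix p assume "p \<in> {p \<in> ?P \<times> ?Q. f p = Z}"
        then obtain A B where AB: "A \<in> ?P" "B \<in> ?Q" "f (A, B) = Z" "p = (A, B)"
          by blast
        have "f (X, A) = f (Y, B)" using XY(3) AB(3) unfolding f_def by auto
        moreover have "f (X, A) \<in> ?P" "f (Y, B) \<in> ?Q"
          by (rule sd[OF P XY(1) AB(1)], rule sd[OF Q XY(2) AB(2)])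
        ultimately have "f (X, A) \<in> ?P \<inter> ?Q" by simp
        then show "f (X, fst p) \<in> ?J" using PQ AB(4) by auto
      qed
      show "finite ?J" using J by simp
    qed
  next
    case True
    show ?thesis unfolding True by simp
  qed
  have f_V: "f p \<in> Pow V" if p: "p \<in> ?P \<times> ?Q" for p
  proof -
    obtain X Y where "p = (X, Y)" "X \<in> ?P" "Y \<in> ?Q" using p by blast
    then have "X \<subseteq> V" "Y \<subseteq> V" unfolding Union_Pow_iff[OF P] Union_Pow_iff[OF Q] by auto
    then show ?thesis by (auto simp: \<open>p = (X, Y)\<close> f_def)
  qed
  have fibres: "D = (\<Union>Z\<in>W. {p \<in> D. f p = Z})" if "\<And>p. p \<in> D \<Longrightarrow> f p \<in> W" for D W
    using that by auto
  have "?P \<times> ?Q = (\<Union>Z\<in>Pow V. {p \<in> ?P \<times> ?Q. f p = Z})"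
    by (rule fibres) (rule f_V)
  then have "card (?P \<times> ?Q) = card (\<Union>Z\<in>Pow V. {p \<in> ?P \<times> ?Q. f p = Z})" by (rule arg_cong)
  also have "\<dots> \<le> (\<Sum>Z\<in>Pow V. card {p \<in> ?P \<times> ?Q. f p = Z})"
    using V by (intro card_UN_le) simp
  also have "\<dots> \<le> (\<Sum>Z\<in>Pow V. card ?J)" by (intro sum_mono fib)
  also have "\<dots> \<le> 2 ^ card V * 2 ^ card J"
    using V J card_image_le[of "Pow J" Union] by (simp add: card_Pow)
  finally have "(2::nat) ^ (card P + card Q) \<le> 2 ^ (card V + card J)"
    using card_Union_Pow[OF partition_onD2[OF P] partition_onD3[OF P] fin(1)]
      card_Union_Pow[OF partition_onD2[OF Q] partition_onD3[OF Q] fin(2)]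
    by (simp add: card_cartesian_product power_add)
  then show ?thesis by simp
qed

section \<open>Reflection of diagrams, and ranks of products\<close>

fun flip :: "vertex \<Rightarrow> vertex" where
  "flip (Upper i) = Lower i"
| "flip (Lower i) = Upper i"
| "flip (Middle i) = Middle i"

text \<open>The standard involution of the partition monoid, which turns a diagram upside down. It
  reverses products and preserves ranks, so statements about one row or one factor carry over to the
  other.\<close>

definition star :: "vertex set set \<Rightarrow> vertex set set" where
  "star a = (image flip) ` a"

lemma flip_flip [simp]: "flip (flip v) = v"
  by (cases v) auto

lemma inj_flip: "inj flip"
  by (metis flip_flip injI)

lemma flip_image_flip [simp]: "flip ` flip ` B = B"
  by (simp add: image_comp)

lemma star_star [simp]: "star (star a) = a"
  by (simp add: star_def image_comp)

lemma glue_flip [simp]: "glue u l (flip v) = glue l u v"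
  by (cases v) (auto simp: glue_def)

lemma flip_vertices: "flip ` vertices n = vertices n"
  by (auto simp: vertices_def image_Un image_comp)

lemma star_in_partitions: "a \<in> partitions n \<Longrightarrow> star a \<in> partitions n"
proof -
  assume a: "a \<in> partitions n"
  then have "(image flip) ` a - {{}} = (image flip) ` a" using block_nonempty by blast
  then show "star a \<in> partitions n"
    using a partition_on_inj_image[of "vertices n" a flip] inj_on_subset[OF inj_flip, of "vertices n"]
    by (simp add: partitions_def star_def flip_vertices)
qed

lemma colourings_star: "colourings (star a) = (colourings a)\<inverse>"
  unfolding colourings_def star_def by (auto simp only: ball_simps glue_flip)

lemma star_product:
  assumes "a \<in> partitions n" "b \<in> partitions n"
  shows "star (partition_product n a b) = partition_product n (star b) (star a)"
  by (rule colourings_inject[of _ n])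
    (simp_all add: assms star_in_partitions colourings_product colourings_star converse_relcomp)

lemma flip_range: "flip ` range Upper = range Lower" "flip ` range Lower = range Upper"
  by (auto simp: image_comp)

lemma transversals_star: "transversals (star a) = star (transversals a)"
proof -
  have "flip ` B \<inter> range Upper \<noteq> {} \<longleftrightarrow> B \<inter> range Lower \<noteq> {}"
    "flip ` B \<inter> range Lower \<noteq> {} \<longleftrightarrow> B \<inter> range Upper \<noteq> {}" for B
    by (metis flip_range(1,2) image_Int inj_flip image_is_empty)+
  then have "{B \<in> a. flip ` B \<inter> range Upper \<noteq> {} \<and> flip ` B \<inter> range Lower \<noteq> {}} = transversals a"
    unfolding transversals_def by meson
  moreover have "transversals (star a) =
      star {B \<in> a. flip ` B \<inter> range Upper \<noteq> {} \<and> flip ` B \<inter> range Lower \<noteq> {}}"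
    unfolding transversals_def star_def by blast
  ultimately show ?thesis by simp
qed

lemma card_star: "card (star a) = card a"
  unfolding star_def by (rule card_image) (metis flip_image_flip inj_on_inverseI)

lemma rank_star [simp]: "partition_rank (star a) = partition_rank a"
  by (simp add: partition_rank_def transversals_star card_star)

text \<open>A Boolean function applied pointwise to functions constant on blocks is constant on
  blocks. Three arguments are provided because the function applied below is a sum of three
  colourings.\<close>

lemma colourings_pointwise:
  assumes a: "a \<in> partitions n"
    and "(u, l) \<in> colourings a" "(u', l') \<in> colourings a" "(u'', l'') \<in> colourings a"
  shows "(\<lambda>i. p (u i) (u' i) (u'' i), \<lambda>i. p (l i) (l' i) (l'' i)) \<in> colourings a"
  unfolding colourings_def
proof clarify
  have glue: "glue (\<lambda>i. p (u i) (u' i) (u'' i)) (\<lambda>i. p (l i) (l' i) (l'' i)) v =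
    p (glue u l v) (glue u' l' v) (glue u'' l'' v)" if "v \<in> vertices n" for v
    using that by (cases v) auto
  fix B x y assume B: "B \<in> a" "x \<in> B" "y \<in> B"
  then have "x \<in> vertices n" "y \<in> vertices n" using block_subset[OF a] by auto
  then show "glue (\<lambda>i. p (u i) (u' i) (u'' i)) (\<lambda>i. p (l i) (l' i) (l'' i)) x =
    glue (\<lambda>i. p (u i) (u' i) (u'' i)) (\<lambda>i. p (l i) (l' i) (l'' i)) y"
    using assms(2-4)[THEN colouringsD, OF B] by (simp add: glue)
qed

text \<open>The relation \<open>R = colourings b\<close> satisfies \<open>R O R\<inverse> O R = R\<close>, because \<open>R\<close> is a subgroup:
  \<open>(x, y'), (x', y'), (x', y) \<in> R\<close> gives \<open>(x - x' + x', y' - y' + y) \<in> R\<close>.\<close>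

lemma product_star_product:
  assumes b: "b \<in> partitions n"
  shows "partition_product n (partition_product n b (star b)) b = b"
proof (rule colourings_inject[of _ n])
  show "colourings (partition_product n (partition_product n b (star b)) b) = colourings b"
    unfolding colourings_product[OF product_in_partitions b]
      colourings_product[OF b star_in_partitions[OF b]] colourings_star
  proof (intro equalityI subsetI; clarify)
    fix u m u' l assume "(u, m) \<in> colourings b" "(u', m) \<in> colourings b" "(u', l) \<in> colourings b"
    \<comment> \<open>The function \<open>x \<noteq> (y \<noteq> z)\<close> is the sum of three bits
      modulo 2, where signs do not matter; the two copies of \<open>u'\<close> cancel, and so do the
      two copies of \<open>m\<close>.\<close>
    from colourings_pointwise[OF b this, of "\<lambda>x y z. x \<noteq> (y \<noteq> z)"]
    have "(\<lambda>i. u i \<noteq> (u' i \<noteq> u' i), \<lambda>i. m i \<noteq> (m i \<noteq> l i)) \<in> colourings b" .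
    moreover have "(\<lambda>i. u i \<noteq> (u' i \<noteq> u' i)) = u" "(\<lambda>i. m i \<noteq> (m i \<noteq> l i)) = l" by auto
    ultimately show "(u, l) \<in> colourings b" by simp
  next
    fix u l assume "(u, l) \<in> colourings b"
    then show "(u, l) \<in> (colourings b O (colourings b)\<inverse>) O colourings b" by blast
  qed
qed (simp_all add: b)

lemma finite_transversals: "a \<in> partitions n \<Longrightarrow> finite (transversals a)"
  by (simp add: finite_partition transversals_def)

lemma upper_block_in_product:
  assumes "a \<in> partitions n" "b \<in> partitions n" "B \<in> a" "Upper i \<in> B" "Upper j \<in> B"
    and K: "K \<in> partition_product n a b" "Upper i \<in> K"
  shows "Upper j \<in> K"
proof (rule same_blockI[OF _ K])
  show "Upper j \<in> vertices n" using block_subset[OF assms(1,3)] assms(5) by blast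
  fix u l assume "(u, l) \<in> colourings (partition_product n a b)"
  then obtain m where "(u, m) \<in> colourings a" using assms(1,2) by (auto simp: colourings_product)
  from colouringsD[OF this assms(3-5)] show "glue u l (Upper i) = glue u l (Upper j)" by simp
qed simp

text \<open>A transversal of \<open>a\<close> has all its upper vertices in one block of
  \<open>ab\<close>, so it suffices that every transversal \<open>K\<close> of \<open>ab\<close>
  shares an upper vertex with a transversal of \<open>a\<close>. Otherwise the upper part of
  \<open>K\<close> would be a union of blocks of \<open>a\<close>, and colouring it alone would
  separate it from the lower part of \<open>K\<close>.\<close>

lemma rank_product_le_left:
  assumes a: "a \<in> partitions n" and b: "b \<in> partitions n"
  shows "partition_rank (partition_product n a b) \<le> partition_rank a"
  unfolding partition_rank_def
proof (rule card_le_if_inj_on_rel[where r = "\<lambda>K T. \<exists>i. Upper i \<in> K \<and> Upper i \<in> T"])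
  show "finite (transversals a)" using a by (rule finite_transversals)
next
  fix K assume "K \<in> transversals (partition_product n a b)"
  then obtain i j where K: "K \<in> partition_product n a b" "Upper i \<in> K" "Lower j \<in> K"
    by (auto simp: transversals_def)
  show "\<exists>T. T \<in> transversals a \<and> (\<exists>i. Upper i \<in> K \<and> Upper i \<in> T)"
  proof (rule ccontr)
    assume no: "\<not> ?thesis"
    let ?X = "K \<inter> range Upper"
    have "(\<lambda>i. Upper i \<in> ?X, \<lambda>i. Lower i \<in> ?X) \<in> colourings a"
    proof (rule indicator_colouring[OF a])
      fix B assume B: "B \<in> a" "B \<inter> ?X \<noteq> {}"
      then obtain k where k: "Upper k \<in> B" "Upper k \<in> K" by auto
      show "B \<subseteq> ?X"
      proof
        fix v assume v: "v \<in> B"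
        show "v \<in> ?X"
        proof (cases v)
          case (Upper j)
          then show ?thesis using upper_block_in_product[OF a b B(1) k(1) _ K(1) k(2)] v by auto
        next
          case (Middle j)
          then show ?thesis using block_subset[OF a B(1)] v by auto
        next
          case (Lower j)
          then have "B \<in> transversals a" using B(1) k v unfolding transversals_def by blast
          then show ?thesis using no k by blast
        qed
      qed
    qed
    moreover have "(\<lambda>i. Lower i \<in> ?X, \<lambda>i. False) \<in> colourings b"
      using indicator_colouring[OF b, of "{}"] by (simp add: image_iff)
    ultimately have "(\<lambda>i. Upper i \<in> ?X, \<lambda>i. False) \<in> colourings (partition_product n a b)"
      unfolding colourings_product[OF a b] by blast
    from colouringsD[OF this K] K(2) show False by simp
  qed
next
  fix K K' T
  assume K: "K \<in> transversals (partition_product n a b)" "K' \<in> transversals (partition_product n a b)"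
    and T: "T \<in> transversals a"
    and "\<exists>i. Upper i \<in> K \<and> Upper i \<in> T" "\<exists>i. Upper i \<in> K' \<and> Upper i \<in> T"
  then obtain i j where "Upper i \<in> K" "Upper i \<in> T" "Upper j \<in> K'" "Upper j \<in> T" by blast
  moreover from this have "Upper j \<in> K"
    using upper_block_in_product[OF a b, of T i j K] K(1) T by (auto simp: transversals_def)
  ultimately show "K = K'"
    using block_eq[of "partition_product n a b" n K K' "Upper j"] K by (simp add: transversals_def)
qed

section \<open>The rank inequality and the twisting\<close>

text \<open>Each block takes the colour of its lower vertices, which agree; a block without lower
  vertices stays uncoloured.\<close>

lemma extend_colouring_upper:
  assumes a: "a \<in> partitions n"
    and X: "\<And>B i j. B \<in> a \<Longrightarrow> Lower i \<in> B \<Longrightarrow> Lower j \<in> B \<Longrightarrow> i \<in> X \<Longrightarrow> j \<in> X"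
  obtains u where "(u, \<lambda>i. i \<in> X) \<in> colourings a"
proof -
  \<comment> \<open>The image of \<open>X\<close> under \<open>Lower\<close> is added for members of
    \<open>X\<close> outside \<open>{1..n}\<close>, which lie in no block.\<close>
  define Y where "Y = \<Union>{B \<in> a. \<exists>i\<in>X. Lower i \<in> B} \<union> Lower ` X"
  have "(\<lambda>i. Upper i \<in> Y, \<lambda>i. Lower i \<in> Y) \<in> colourings a"
  proof (rule indicator_colouring[OF a])
    fix B assume B: "B \<in> a" "B \<inter> Y \<noteq> {}"
    then obtain v where v: "v \<in> B" "v \<in> Y" by blast
    from v(2) consider C i where "C \<in> a" "i \<in> X" "Lower i \<in> C" "v \<in> C" | i where "v = Lower i" "i \<in> X"
      unfolding Y_def by blast
    then have "\<exists>i\<in>X. Lower i \<in> B"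
      using v block_eq[OF a B(1), of _ v] by cases auto
    then show "B \<subseteq> Y" using B(1) unfolding Y_def by blast
  qed
  moreover have "(\<lambda>i. Lower i \<in> Y) = (\<lambda>i. i \<in> X)"
    unfolding Y_def using X by auto
  ultimately show thesis using that by simp
qed

lemma extend_colouring_lower:
  assumes b: "b \<in> partitions n"
    and X: "\<And>B i j. B \<in> b \<Longrightarrow> Upper i \<in> B \<Longrightarrow> Upper j \<in> B \<Longrightarrow> i \<in> X \<Longrightarrow> j \<in> X"
  obtains l where "(\<lambda>i. i \<in> X, l) \<in> colourings b"
proof -
  have X': "j \<in> X" if "B \<in> star b" "Lower i \<in> B" "Lower j \<in> B" "i \<in> X" for B i j
  proof -
    obtain C where C: "C \<in> b" "B = flip ` C" using \<open>B \<in> star b\<close> unfolding star_def by blast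
    have "Upper i \<in> C" "Upper j \<in> C"
      using imageI[OF that(2), of flip] imageI[OF that(3), of flip] by (simp_all add: C(2))
    then show ?thesis using X[OF C(1)] \<open>i \<in> X\<close> by blast
  qed
  obtain u where "(u, \<lambda>i. i \<in> X) \<in> colourings (star b)"
    using extend_colouring_upper[OF star_in_partitions[OF b], of X] X' by metis
  then show thesis using that by (simp add: colourings_star)
qed

text \<open>For \<open>f\<close> one of \<open>Upper\<close> and \<open>Lower\<close>, the preimages
  are the traces of the blocks on one row, where the traces of two different partitions can be
  compared. Disjoint blocks have distinct nonempty traces, so nothing is lost in the count.\<close>

lemma card_blocks_meeting:
  assumes a: "a \<in> partitions n" and f: "inj f"
  shows "card ((-`) f ` a - {{}}) = card {B \<in> a. B \<inter> range f \<noteq> {}}"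
proof -
  have "inj_on ((-`) f) {B \<in> a. B \<inter> range f \<noteq> {}}"
  proof (rule inj_onI)
    fix B C assume B: "B \<in> {B \<in> a. B \<inter> range f \<noteq> {}}" and C: "C \<in> {B \<in> a. B \<inter> range f \<noteq> {}}"
      and eq: "f -` B = f -` C"
    then obtain i where "f i \<in> B" by blast
    moreover from this eq have "f i \<in> C" by blast
    ultimately show "B = C" using block_eq[OF a] B C by blast
  qed
  moreover have "(-`) f ` a - {{}} = (-`) f ` {B \<in> a. B \<inter> range f \<noteq> {}}" by blast
  ultimately show ?thesis by (simp add: card_image)
qed

lemma block_rows: "a \<in> partitions n \<Longrightarrow> B \<in> a \<Longrightarrow> B \<subseteq> range Upper \<union> range Lower"
  using block_subset[of a n B] by (force simp: vertices_def)

lemma Upper_Lower_disjoint: "range Upper \<inter> range Lower = {}"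
  by auto

lemma card_Lower_blocks:
  assumes "a \<in> partitions n"
  shows "card {B \<in> a. B \<inter> range Lower \<noteq> {}} = partition_rank a + card {B \<in> a. B \<subseteq> range Lower}"
proof -
  have "{B \<in> a. B \<inter> range Lower \<noteq> {}} = transversals a \<union> {B \<in> a. B \<subseteq> range Lower}"
  proof (rule Set.set_eqI)
    fix B
    have "B \<inter> range Lower \<noteq> {} \<longleftrightarrow>
        B \<inter> range Upper \<noteq> {} \<and> B \<inter> range Lower \<noteq> {} \<or> B \<subseteq> range Lower" if "B \<in> a"
      using block_rows[OF assms that] block_nonempty[OF assms that] Upper_Lower_disjoint by blast
    then show "B \<in> {B \<in> a. B \<inter> range Lower \<noteq> {}} \<longleftrightarrow>
        B \<in> transversals a \<union> {B \<in> a. B \<subseteq> range Lower}"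
      by (cases "B \<in> a") (simp_all add: transversals_def)
  qed
  moreover have "transversals a \<inter> {B \<in> a. B \<subseteq> range Lower} = {}"
    unfolding transversals_def using Upper_Lower_disjoint by blast
  ultimately show ?thesis
    using finite_partition[OF assms] finite_transversals[OF assms]
    by (simp add: card_Un_disjoint partition_rank_def)
qed

lemma card_Upper_blocks:
  assumes "a \<in> partitions n"
  shows "card {B \<in> a. B \<inter> range Upper \<noteq> {}} = partition_rank a + card {B \<in> a. B \<subseteq> range Upper}"
proof -
  have "{B \<in> a. B \<inter> range Upper \<noteq> {}} = transversals a \<union> {B \<in> a. B \<subseteq> range Upper}"
  proof (rule Set.set_eqI)
    fix B
    have "B \<inter> range Upper \<noteq> {} \<longleftrightarrow>
        B \<inter> range Upper \<noteq> {} \<and> B \<inter> range Lower \<noteq> {} \<or> B \<subseteq> range Upper" if "B \<in> a"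
      using block_rows[OF assms that] block_nonempty[OF assms that] Upper_Lower_disjoint by blast
    then show "B \<in> {B \<in> a. B \<inter> range Upper \<noteq> {}} \<longleftrightarrow>
        B \<in> transversals a \<union> {B \<in> a. B \<subseteq> range Upper}"
      by (cases "B \<in> a") (simp_all add: transversals_def)
  qed
  moreover have "transversals a \<inter> {B \<in> a. B \<subseteq> range Upper} = {}"
    unfolding transversals_def using Upper_Lower_disjoint by blast
  ultimately show ?thesis
    using finite_partition[OF assms] finite_transversals[OF assms]
    by (simp add: card_Un_disjoint partition_rank_def)
qed

text \<open>The join on the middle row of the traces of \<open>a\<close> and \<open>b\<close> has at least \<open>|P| + |Q| - n\<close> classes.
  Each class that does not meet transversals of both factors contains a block of \<open>a\<close> in the lower row
  or of \<open>b\<close> in the upper row, and all others lie in different transversals of \<open>ab\<close>.\<close>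

lemma rank_add_rank_le:
  assumes a: "a \<in> partitions n" and b: "b \<in> partitions n"
  shows "partition_rank a + partition_rank b \<le> n + partition_rank (partition_product n a b)"
proof -
  let ?ab = "partition_product n a b"
  \<comment> \<open>The colourings of the middle row that extend to both factors. Middle vertices
    are \<open>same\<close> iff no such colouring separates them; this describes the join of the two
    traces without chains of overlapping blocks.\<close>
  define M where "M = Range (colourings a) \<inter> Domain (colourings b)"
  define same where "same i j \<longleftrightarrow> (\<forall>m\<in>M. m i = m j)" for i j
  define R where "R = {(i, j) \<in> {1..n} \<times> {1..n}. same i j}"
  define J where "J = {1..n} // R"
  define P where "P = (-`) Lower ` a - {{}}"
  define Q where "Q = (-`) Upper ` b - {{}}"
  have "same i i" for i by (simp add: same_def)
  moreover have "same j i" if "same i j" for i j using that unfolding same_def by metis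
  moreover have "same i k" if "same i j" "same j k" for i j k using that unfolding same_def by metis
  ultimately have equiv: "equiv {1..n} R"
    unfolding R_def by (intro equivI refl_onI symI transI) blast+
  have partJ: "partition_on {1..n} J"
    unfolding J_def using partition_on_quotient[OF equiv] .
  have "Lower -` vertices n = {1..n}" "Upper -` vertices n = {1..n}"
    by (auto simp: vertices_def)
  then have partP: "partition_on {1..n} P" and partQ: "partition_on {1..n} Q"
    unfolding P_def Q_def using partition_on_vimage[of "vertices n" a Lower]
      partition_on_vimage[of "vertices n" b Upper] a b by (simp_all add: partitions_def)
  have sim: "m i = m j" if "C \<in> J" "i \<in> C" "j \<in> C" "m \<in> M" for C i j m
  proof -
    have "(i, j) \<in> R" using that(1-3) quotient_eq_iff[OF equiv, of C C i j] unfolding J_def by simp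
    then have "same i j" unfolding R_def by blast
    then show ?thesis using that(4) unfolding same_def by simp
  qed
  have same_class: "C = D"
    if "C \<in> J" "D \<in> J" "i \<in> C" "j \<in> D" "\<And>m. m \<in> M \<Longrightarrow> m i = m j" for C D i j
  proof -
    have "i \<in> {1..n}" "j \<in> {1..n}" using that partition_onD1[OF partJ] by auto
    moreover have "same i j" using that(5) unfolding same_def by simp
    ultimately have "(i, j) \<in> R" unfolding R_def by simp
    then show ?thesis using that(1-4) quotient_eq_iff[OF equiv, of C D i j] unfolding J_def by simp
  qed
  have finJ: "finite J" using finite_elements[OF _ partJ] by simp
  have in_M: "(\<lambda>i. i \<in> X) \<in> M"
    if X: "\<And>B. B \<in> P \<Longrightarrow> B \<inter> X \<noteq> {} \<Longrightarrow> B \<subseteq> X" "\<And>B. B \<in> Q \<Longrightarrow> B \<inter> X \<noteq> {} \<Longrightarrow> B \<subseteq> X" for X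
  proof -
    have "j \<in> X" if "B \<in> a" "Lower i \<in> B" "Lower j \<in> B" "i \<in> X" for B i j
      using X(1)[of "Lower -` B"] that unfolding P_def by blast
    then obtain u where "(u, \<lambda>i. i \<in> X) \<in> colourings a" using extend_colouring_upper[OF a] by metis
    moreover have "j \<in> X" if "B \<in> b" "Upper i \<in> B" "Upper j \<in> B" "i \<in> X" for B i j
      using X(2)[of "Upper -` B"] that unfolding Q_def by blast
    then obtain l where "(\<lambda>i. i \<in> X, l) \<in> colourings b" using extend_colouring_lower[OF b] by metis
    ultimately show ?thesis unfolding M_def by blast
  qed
  \<comment> \<open>A set that is a union of classes of both traces has its indicator in
    \<open>M\<close>, so no class of \<open>J\<close> can be cut by it.\<close>
  have "card P + card Q \<le> card {1..n} + card J"
  proof (rule card_partitions_le[OF _ partP partQ finJ])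
    show "Union ` Pow P \<inter> Union ` Pow Q \<subseteq> Union ` Pow J"
    proof
      fix X assume X: "X \<in> Union ` Pow P \<inter> Union ` Pow Q"
      have XP: "X \<subseteq> {1..n} \<and> (\<forall>B\<in>P. B \<inter> X \<noteq> {} \<longrightarrow> B \<subseteq> X)"
        by (rule iffD1[OF Union_Pow_iff[OF partP]]) (rule IntD1[OF X])
      have XQ: "X \<subseteq> {1..n} \<and> (\<forall>B\<in>Q. B \<inter> X \<noteq> {} \<longrightarrow> B \<subseteq> X)"
        by (rule iffD1[OF Union_Pow_iff[OF partQ]]) (rule IntD2[OF X])
      have X: "X \<subseteq> {1..n}" "(\<lambda>i. i \<in> X) \<in> M"
        using XP by simp (rule in_M; use XP XQ in simp)
      have "C \<subseteq> X" if C: "C \<in> J" "C \<inter> X \<noteq> {}" for C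
      proof
        fix j assume "j \<in> C"
        obtain i where "i \<in> C" "i \<in> X" using C(2) by blast
        with sim[OF C(1) \<open>i \<in> C\<close> \<open>j \<in> C\<close> X(2)] show "j \<in> X" by simp
      qed
      then show "X \<in> Union ` Pow J" by (intro iffD2[OF Union_Pow_iff[OF partJ]]) (use X(1) in simp)
    qed
  qed simp
  moreover have "card P = partition_rank a + card {B \<in> a. B \<subseteq> range Lower}"
    "card Q = partition_rank b + card {B \<in> b. B \<subseteq> range Upper}"
    unfolding P_def Q_def
    by (simp_all add: card_blocks_meeting[OF a] card_blocks_meeting[OF b]
        card_Lower_blocks[OF a] card_Upper_blocks[OF b] inj_def)
  moreover
  define G where "G = {C \<in> J. (\<exists>A\<in>transversals a. \<exists>i\<in>C. Lower i \<in> A)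
    \<and> (\<exists>B\<in>transversals b. \<exists>i\<in>C. Upper i \<in> B)}"
  have "card J = card G + card (J - G)"
    using finJ card_Un_disjoint[of G "J - G"] by (simp add: G_def Un_absorb1 Int_Diff)
  moreover have "card (J - G) \<le> card {B \<in> a. B \<subseteq> range Lower} + card {B \<in> b. B \<subseteq> range Upper}"
  proof -
    let ?r = "\<lambda>C D. case D of Inl B \<Rightarrow> \<exists>i\<in>C. Lower i \<in> B | Inr B \<Rightarrow> \<exists>i\<in>C. Upper i \<in> B"
    let ?S = "{B \<in> a. B \<subseteq> range Lower} <+> {B \<in> b. B \<subseteq> range Upper}"
    have "card (J - G) \<le> card ?S"
    proof (rule card_le_if_inj_on_rel[where r = ?r])
      show "finite ?S" using finite_partition a b by simp
    next
      fix C assume C: "C \<in> J - G"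
      then obtain i where i: "i \<in> C" using partition_onD3[OF partJ] by (cases "C = {}") auto
      then have n: "i \<in> {1..n}" using C partition_onD1[OF partJ] by blast
      obtain A where A: "A \<in> a" "Lower i \<in> A" using block_exists[OF a, of "Lower i"] n by auto
      obtain B where B: "B \<in> b" "Upper i \<in> B" using block_exists[OF b, of "Upper i"] n by auto
      have "A \<notin> transversals a \<or> B \<notin> transversals b" using C i A B unfolding G_def by blast
      then show "\<exists>D. D \<in> ?S \<and> ?r C D"
      proof
        assume "A \<notin> transversals a"
        then have "A \<subseteq> range Lower" using A block_rows[OF a A(1)] unfolding transversals_def by blast
        then show ?thesis using A i by (intro exI[of _ "Inl A"]) auto
      next
        assume "B \<notin> transversals b"
        then have "B \<subseteq> range Upper" using B block_rows[OF b B(1)] unfolding transversals_def by blast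
        then show ?thesis using B i by (intro exI[of _ "Inr B"]) auto
      qed
    next
      fix C C' D assume C: "C \<in> J - G" "C' \<in> J - G" and D: "D \<in> ?S" "?r C D" "?r C' D"
      show "C = C'"
      proof (cases D)
        case (Inl B)
        then obtain i j where *: "B \<in> a" "i \<in> C" "j \<in> C'" "Lower i \<in> B" "Lower j \<in> B" using D by auto
        show ?thesis
        proof (rule same_class[OF _ _ *(2,3)])
          fix m assume "m \<in> M"
          then obtain u where "(u, m) \<in> colourings a" unfolding M_def by blast
          from colouringsD[OF this *(1,4,5)] show "m i = m j" by simp
        qed (use C in auto)
      next
        case (Inr B)
        then obtain i j where *: "B \<in> b" "i \<in> C" "j \<in> C'" "Upper i \<in> B" "Upper j \<in> B" using D by auto
        show ?thesis
        proof (rule same_class[OF _ _ *(2,3)])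
          fix m assume "m \<in> M"
          then obtain l where "(m, l) \<in> colourings b" unfolding M_def by blast
          from colouringsD[OF this *(1,4,5)] show "m i = m j" by simp
        qed (use C in auto)
      qed
    qed
    also have "card ?S = card {B \<in> a. B \<subseteq> range Lower} + card {B \<in> b. B \<subseteq> range Upper}"
      using finite_partition a b by (intro card_Plus) auto
    finally show ?thesis .
  qed
  moreover have "card G \<le> partition_rank ?ab"
    unfolding partition_rank_def
  proof (rule card_le_if_inj_on_rel[where
        r = "\<lambda>C K. \<exists>i\<in>C. \<exists>x. Upper x \<in> K \<and> (\<exists>A\<in>a. Upper x \<in> A \<and> Lower i \<in> A)"])
    show "finite (transversals ?ab)" by (rule finite_transversals[of _ n]) simp
  next
    fix C assume "C \<in> G"
    then obtain A i B j where C: "C \<in> J" and A: "A \<in> transversals a" "i \<in> C" "Lower i \<in> A"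
      and B: "B \<in> transversals b" "j \<in> C" "Upper j \<in> B" unfolding G_def by blast
    obtain x where x: "Upper x \<in> A" "A \<in> a" using A(1) unfolding transversals_def by blast
    obtain y where y: "Lower y \<in> B" "B \<in> b" using B(1) unfolding transversals_def by blast
    have "Upper x \<in> vertices n" using block_subset[OF a] x by blast
    then obtain K where K: "K \<in> ?ab" "Upper x \<in> K"
      by (rule block_exists[OF product_in_partitions])
    have "Lower y \<in> K"
    proof (rule same_blockI[OF _ K])
      show "Lower y \<in> vertices n" using block_subset[OF b] y by blast
      fix u l assume "(u, l) \<in> colourings ?ab"
      then obtain m where m: "(u, m) \<in> colourings a" "(m, l) \<in> colourings b"
        unfolding colourings_product[OF a b] by blast
      then have "m \<in> M" unfolding M_def by blast
      have "u x = m i" using colouringsD[OF m(1) x(2) x(1) A(3)] by simp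
      also have "m i = m j" by (rule sim[OF C A(2) B(2) \<open>m \<in> M\<close>])
      also have "m j = l y" using colouringsD[OF m(2) y(2) B(3) y(1)] by simp
      finally show "glue u l (Upper x) = glue u l (Lower y)" by simp
    qed simp
    then have "K \<in> transversals ?ab" using K unfolding transversals_def by blast
    then show "\<exists>K. K \<in> transversals ?ab \<and>
        (\<exists>i\<in>C. \<exists>x. Upper x \<in> K \<and> (\<exists>A\<in>a. Upper x \<in> A \<and> Lower i \<in> A))"
      using K x A by blast
  next
    fix C D K assume CD: "C \<in> G" "D \<in> G" and K: "K \<in> transversals ?ab"
      and "\<exists>i\<in>C. \<exists>x. Upper x \<in> K \<and> (\<exists>A\<in>a. Upper x \<in> A \<and> Lower i \<in> A)"
        "\<exists>i\<in>D. \<exists>x. Upper x \<in> K \<and> (\<exists>A\<in>a. Upper x \<in> A \<and> Lower i \<in> A)"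
    then obtain i x A j y B where C: "i \<in> C" "Upper x \<in> K" "A \<in> a" "Upper x \<in> A" "Lower i \<in> A"
      and D: "j \<in> D" "Upper y \<in> K" "B \<in> a" "Upper y \<in> B" "Lower j \<in> B"
      by blast
    show "C = D"
    proof (rule same_class[OF _ _ C(1) D(1)])
      fix m assume "m \<in> M"
      then obtain u l where m: "(u, m) \<in> colourings a" "(m, l) \<in> colourings b"
        unfolding M_def by blast
      then have ul: "(u, l) \<in> colourings ?ab" unfolding colourings_product[OF a b] by blast
      have "m i = u x" using colouringsD[OF m(1) C(3,5,4)] by simp
      also have "u x = u y"
        using colouringsD[OF ul _ C(2) D(2)] K unfolding transversals_def by simp
      also have "u y = m j" using colouringsD[OF m(1) D(3,4,5)] by simp
      finally show "m i = m j" .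
    qed (use CD in \<open>auto simp: G_def\<close>)
  qed
  \<comment> \<open>The non-transversal blocks counted in \<open>card P\<close> and
    \<open>card Q\<close> cancel against the bound for \<open>J - G\<close>; the two ranks,
    \<open>n\<close> and \<open>card G\<close> remain.\<close>
  ultimately show ?thesis by simp
qed

text \<open>By associativity, both sides of the cocycle identity are 2n - rank a - rank b - rank c +
  rank abc. The rank inequality enters only in showing that the values are natural numbers.\<close>

lemma twisting_rank:
  assumes "carrier S \<subseteq> partitions n" "monoid.mult S = partition_product n"
  shows "twisting S (rank_twisting n)"
proof -
  have "rank_twisting n a b \<in> \<nat>" if "a \<in> carrier S" "b \<in> carrier S" for a b
  proof -
    have "partition_rank a + partition_rank b \<le> n + partition_rank (partition_product n a b)"
      using rank_add_rank_le that assms(1) by blast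
    then show ?thesis by (simp add: rank_twisting_def partition_monoid_def Nats_altdef1)
  qed
  moreover have "rank_twisting n a b + rank_twisting n (partition_product n a b) c
      = rank_twisting n a (partition_product n b c) + rank_twisting n b c"
    if "a \<in> carrier S" "b \<in> carrier S" "c \<in> carrier S" for a b c
  proof -
    have "a \<in> partitions n" "b \<in> partitions n" "c \<in> partitions n" using that assms(1) by auto
    then show ?thesis by (simp add: rank_twisting_def partition_monoid_def product_assoc)
  qed
  ultimately show ?thesis by (simp add: twisting_def assms(2))
qed

section \<open>Surgery on set partitions, and closure of the Brauer monoid under products\<close>

lemma partition_on_Un:
  assumes "partition_on A P" "partition_on B Q" "A \<inter> B = {}"
  shows "partition_on (A \<union> B) (P \<union> Q)"
proof (rule partition_onI)
  show "\<Union>(P \<union> Q) = A \<union> B"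
    using partition_onD1[OF assms(1)] partition_onD1[OF assms(2)] by simp
  fix p q assume pq: "p \<in> P \<union> Q" "q \<in> P \<union> Q" "p \<noteq> q"
  have sub: "p \<subseteq> A" if "p \<in> P" for p using partition_onD1[OF assms(1)] that by blast
  have sub': "p \<subseteq> B" if "p \<in> Q" for p using partition_onD1[OF assms(2)] that by blast
  show "disjnt p q"
    using pq disjointD[OF partition_onD2[OF assms(1)], of p q]
      disjointD[OF partition_onD2[OF assms(2)], of p q] sub sub' assms(3)
    unfolding disjnt_def by blast
next
  show "{} \<notin> P \<union> Q" using partition_onD3[OF assms(1)] partition_onD3[OF assms(2)] by blast
qed

lemma partition_on_subset:
  assumes "partition_on V P" "W \<subseteq> V" "\<And>B. B \<in> P \<Longrightarrow> B \<inter> W \<noteq> {} \<Longrightarrow> B \<subseteq> W"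
  shows "partition_on W {B \<in> P. B \<subseteq> W}"
proof (rule partition_onI)
  show "\<Union>{B \<in> P. B \<subseteq> W} = W"
    using assms(2,3) partition_onD1[OF assms(1)] by blast
  show "disjnt p q" if "p \<in> {B \<in> P. B \<subseteq> W}" "q \<in> {B \<in> P. B \<subseteq> W}" "p \<noteq> q" for p q
    using that disjointD[OF partition_onD2[OF assms(1)], of p q] by (simp add: disjnt_def)
  show "{} \<notin> {B \<in> P. B \<subseteq> W}" using partition_onD3[OF assms(1)] by blast
qed

lemma partition_on_replace:
  assumes "partition_on V P" "A \<subseteq> P" "partition_on (\<Union>A) C"
  shows "partition_on V ((P - A) \<union> C)"
proof -
  have V: "V = \<Union>(P - A) \<union> \<Union>A" using partition_onD1[OF assms(1)] assms(2) by blast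
  have eq: "p \<inter> q = {}" if "p \<in> P" "q \<in> P" "p \<noteq> q" for p q
    using disjointD[OF partition_onD2[OF assms(1)] that] .
  have disj: "\<Union>(P - A) \<inter> \<Union>A = {}"
  proof (rule ccontr)
    assume "\<Union>(P - A) \<inter> \<Union>A \<noteq> {}"
    then obtain x p q where "p \<in> P - A" "q \<in> A" "x \<in> p" "x \<in> q" by blast
    then show False using eq[of p q] assms(2) by auto
  qed
  have "partition_on (\<Union>(P - A)) (P - A)"
    by (rule partition_onI) (use eq partition_onD3[OF assms(1)] in \<open>auto simp: disjnt_def\<close>)
  from partition_on_Un[OF this assms(3) disj] show ?thesis unfolding V .
qed

text \<open>A factor touches only two of the three rows of the product graph. Singletons on the
  third row \<open>S\<close> make it a partition of all three, so that both factors partition the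
  same set.\<close>

lemma partition_on_pad:
  assumes "partition_on V P" "inj_on f V" "f ` V \<inter> S = {}"
  shows "partition_on (f ` V \<union> S) ((image f) ` P \<union> (\<lambda>s. {s}) ` S)"
proof -
  have "(image f) ` P - {{}} = (image f) ` P" using partition_onD3[OF assms(1)] by blast
  then show ?thesis
    using partition_on_Un[OF partition_on_inj_image[OF assms(1,2)] partition_on_singletons assms(3)]
    by simp
qed

text \<open>A pair contributes two vertices to \<open>W\<close> and a singleton only one. Counting
  the singletons a second time therefore gives two for every block.\<close>

lemma card_pad:
  assumes P: "partition_on V P" and f: "inj_on f V" and S: "f ` V \<inter> S = {}" and "finite V" "finite S"
    and two: "\<And>B. B \<in> P \<Longrightarrow> card B = 2"
    and W: "W \<subseteq> f ` V \<union> S" "\<And>B. B \<in> (image f) ` P \<union> (\<lambda>s. {s}) ` S \<Longrightarrow> B \<inter> W \<noteq> {} \<Longrightarrow> B \<subseteq> W"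
  shows "card W + card (W \<inter> S) = 2 * card {B \<in> (image f) ` P \<union> (\<lambda>s. {s}) ` S. B \<subseteq> W}"
proof -
  let ?P1 = "{B \<in> (image f) ` P. B \<subseteq> W}" and ?P2 = "(\<lambda>s. {s}) ` (W \<inter> S)"
  have part: "partition_on W {B \<in> (image f) ` P \<union> (\<lambda>s. {s}) ` S. B \<subseteq> W}"
    by (rule partition_on_subset[OF partition_on_pad[OF P f S] W])
  have "{B \<in> (image f) ` P \<union> (\<lambda>s. {s}) ` S. B \<subseteq> W} = ?P1 \<union> ?P2" by auto
  note part = part[unfolded this] and eq = this
  have fin: "finite W" using W(1) \<open>finite V\<close> \<open>finite S\<close> by (auto intro: finite_subset)
  have finP: "finite ?P1" "finite ?P2"
    using finite_elements[OF fin part] by auto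
  have card1: "card B = 2" if "B \<in> ?P1" for B
  proof -
    from that obtain C where "C \<in> P" "B = f ` C" by blast
    moreover from this have "inj_on f C" using partition_onD1[OF P] f by (meson Union_upper inj_on_subset)
    ultimately show ?thesis using two by (simp add: card_image)
  qed
  have disj: "?P1 \<inter> ?P2 = {}"
  proof (rule ccontr)
    assume "?P1 \<inter> ?P2 \<noteq> {}"
    then obtain s where "{s} \<in> ?P1" by blast
    from card1[OF this] show False by simp
  qed
  have "card W = (\<Sum>B\<in>?P1 \<union> ?P2. card B)"
    using product_partition[OF part] fin part
    by (metis (no_types, lifting) Union_upper finite_subset partition_onD1)
  also have "\<dots> = (\<Sum>B\<in>?P1. card B) + (\<Sum>B\<in>?P2. card B)"
    by (rule sum.union_disjoint[OF finP disj])
  also have "(\<Sum>B\<in>?P1. card B) = 2 * card ?P1" using card1 by simp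
  also have "(\<Sum>B\<in>?P2. card B) = card (W \<inter> S)" by (simp add: sum.reindex)
  finally have "card W = 2 * card ?P1 + card (W \<inter> S)" .
  moreover have "card ?P2 = card (W \<inter> S)" by (rule card_image) simp
  ultimately show ?thesis unfolding eq by (simp add: card_Un_disjoint[OF finP disj])
qed

text \<open>Let \<open>W\<close> be the component of the product graph that contains the block \<open>K\<close> of \<open>ab\<close>. Outer
  vertices have degree 1 and middle ones degree 2, so \<open>W\<close> has \<open>|W| - |K| / 2\<close> edges, and \<open>|W| - 1\<close>
  are needed to connect it. Hence \<open>|K| \<le> 2\<close>, and \<open>|K|\<close> is even because \<open>a\<close> and \<open>b\<close> are perfect
  matchings.\<close>

lemma product_in_brauer:
  assumes a: "a \<in> brauer n" and b: "b \<in> brauer n"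
  shows "partition_product n a b \<in> brauer n"
proof -
  let ?ab = "partition_product n a b"
  have pa: "a \<in> partitions n" and pb: "b \<in> partitions n" using a b by (auto simp: brauer_def)
  have part: "partition_on (vertices n) a" "partition_on (vertices n) b"
    using pa pb by (auto simp: partitions_def)
  \<comment> \<open>Colourings of all three rows: the count concerns whole components of the product
    graph, whose middle vertices are invisible in \<open>?ab\<close>.\<close>
  define G :: "(vertex \<Rightarrow> bool) set" where
    "G = {g. (g \<circ> Upper, g \<circ> Middle) \<in> colourings a \<and> (g \<circ> Middle, g \<circ> Lower) \<in> colourings b}"
  define eqv where "eqv v w \<longleftrightarrow> (\<forall>g\<in>G. g v = g w)" for v w
  have eqv_trans: "eqv u w" if "eqv u v" "eqv v w" for u v w using that unfolding eqv_def by metis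
  have glue_a: "glue (g \<circ> Upper) (g \<circ> Middle) v = g (lower_to_middle v)" if "v \<in> vertices n" for g v
    using that by (cases v) auto
  have glue_b: "glue (g \<circ> Middle) (g \<circ> Lower) v = g (upper_to_middle v)" if "v \<in> vertices n" for g v
    using that by (cases v) auto
  have eqv_a: "eqv v w" if B: "B \<in> a" and vw: "v \<in> lower_to_middle ` B" "w \<in> lower_to_middle ` B" for B v w
    unfolding eqv_def
  proof
    fix g assume "g \<in> G"
    then have g: "(g \<circ> Upper, g \<circ> Middle) \<in> colourings a" unfolding G_def by blast
    obtain x y where xy: "x \<in> B" "y \<in> B" "v = lower_to_middle x" "w = lower_to_middle y" using vw by blast
    then have "x \<in> vertices n" "y \<in> vertices n" using block_subset[OF pa B] by auto
    then show "g v = g w" using colouringsD[OF g B xy(1,2)] xy(3,4) by (simp only: glue_a)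
  qed
  have eqv_b: "eqv v w" if B: "B \<in> b" and vw: "v \<in> upper_to_middle ` B" "w \<in> upper_to_middle ` B" for B v w
    unfolding eqv_def
  proof
    fix g assume "g \<in> G"
    then have g: "(g \<circ> Middle, g \<circ> Lower) \<in> colourings b" unfolding G_def by blast
    obtain x y where xy: "x \<in> B" "y \<in> B" "v = upper_to_middle x" "w = upper_to_middle y" using vw by blast
    then have "x \<in> vertices n" "y \<in> vertices n" using block_subset[OF pb B] by auto
    then show "g v = g w" using colouringsD[OF g B xy(1,2)] xy(3,4) by (simp only: glue_b)
  qed
  have eqv_block: "eqv x v \<longleftrightarrow> v \<in> K" if K: "K \<in> ?ab" "x \<in> K" and v: "v \<in> vertices n" for K x v
  proof -
    have xn: "x \<in> vertices n" using K block_subset[OF product_in_partitions] by blast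
    have glue: "glue (g \<circ> Upper) (g \<circ> Lower) w = g w" if "w \<in> vertices n" for g w
      using that by (cases w) auto
    show ?thesis
    proof
      assume "eqv x v"
      show "v \<in> K"
      proof (rule same_blockI[OF _ K v])
        fix u l assume "(u, l) \<in> colourings ?ab"
        then obtain m where m: "(u, m) \<in> colourings a" "(m, l) \<in> colourings b"
          unfolding colourings_product[OF pa pb] by blast
        define g where "g w = (case w of Upper i \<Rightarrow> u i | Middle i \<Rightarrow> m i | Lower i \<Rightarrow> l i)" for w
        have g: "g \<circ> Upper = u" "g \<circ> Middle = m" "g \<circ> Lower = l" by (auto simp: g_def)
        then have "g \<in> G" using m by (simp add: G_def)
        then have "g x = g v" using \<open>eqv x v\<close> by (simp add: eqv_def)
        then show "glue u l x = glue u l v" using glue[OF xn, of g] glue[OF v, of g] by (simp add: g)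
      qed simp
    next
      assume "v \<in> K"
      show "eqv x v" unfolding eqv_def
      proof
        fix g assume "g \<in> G"
        then have "(g \<circ> Upper, g \<circ> Lower) \<in> colourings ?ab"
          unfolding G_def colourings_product[OF pa pb] by blast
        from colouringsD[OF this K \<open>v \<in> K\<close>] show "g x = g v" by (simp only: glue[OF xn] glue[OF v])
      qed
    qed
  qed
  have "card K = 2" if K: "K \<in> ?ab" for K
  proof -
    obtain x where x: "x \<in> K" using block_nonempty[OF product_in_partitions K] by blast
    define V where "V = vertices n \<union> Middle ` {1..n}"
    define W where "W = {v \<in> V. eqv x v}"
    let ?U = "Upper ` {1..n}" and ?L = "Lower ` {1..n}"
    have Va: "V = lower_to_middle ` vertices n \<union> ?L" and Vb: "V = upper_to_middle ` vertices n \<union> ?U"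
      by (auto simp: V_def vertices_def image_Un image_comp)
    have inj: "inj_on lower_to_middle (vertices n)" "inj_on upper_to_middle (vertices n)"
      by (auto simp: inj_on_def vertices_def)
    have disj: "lower_to_middle ` vertices n \<inter> ?L = {}" "upper_to_middle ` vertices n \<inter> ?U = {}"
      by (auto simp: vertices_def)
    define A where "A = (image lower_to_middle) ` a \<union> (\<lambda>s. {s}) ` ?L"
    define B where "B = (image upper_to_middle) ` b \<union> (\<lambda>s. {s}) ` ?U"
    have partA: "partition_on V A" and partB: "partition_on V B"
      unfolding A_def B_def Va by (rule partition_on_pad[OF part(1) inj(1) disj(1)])
        (unfold Va[symmetric] Vb, rule partition_on_pad[OF part(2) inj(2) disj(2)])
    have WV: "W \<subseteq> V" unfolding W_def by blast
    have x_refl: "eqv x x" unfolding eqv_def by simp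
    have satA: "D \<subseteq> W" if D: "D \<in> A" "D \<inter> W \<noteq> {}" for D
    proof
      fix v assume v: "v \<in> D"
      obtain w where w: "w \<in> D" "w \<in> W" using D(2) by blast
      have "v \<in> V" using v D(1) partition_onD1[OF partA] by blast
      moreover have "eqv w v" using D(1) w(1) v eqv_a unfolding A_def by (auto simp: eqv_def)
      ultimately show "v \<in> W" using w(2) eqv_trans unfolding W_def by blast
    qed
    have satB: "D \<subseteq> W" if D: "D \<in> B" "D \<inter> W \<noteq> {}" for D
    proof
      fix v assume v: "v \<in> D"
      obtain w where w: "w \<in> D" "w \<in> W" using D(2) by blast
      have "v \<in> V" using v D(1) partition_onD1[OF partB] by blast
      moreover have "eqv w v" using D(1) w(1) v eqv_b unfolding B_def by (auto simp: eqv_def)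
      ultimately show "v \<in> W" using w(2) eqv_trans unfolding W_def by blast
    qed
    have finW: "finite W" using WV by (rule finite_subset) (simp add: V_def)
    let ?A = "{D \<in> A. D \<subseteq> W}" and ?B = "{D \<in> B. D \<subseteq> W}"
    have partAW: "partition_on W ?A" and partBW: "partition_on W ?B"
      using partition_on_subset[OF partA WV satA] partition_on_subset[OF partB WV satB] by blast+
    \<comment> \<open>A union of blocks of both padded matchings is \<open>{}\<close> or
      \<open>W\<close>, because \<open>W\<close> is a single component. So the join has one class,
      which accounts for the summand \<open>card {W}\<close>.\<close>
    have "card ?A + card ?B \<le> card W + card {W}"
    proof (rule card_partitions_le[OF finW partAW partBW])
      show "Union ` Pow ?A \<inter> Union ` Pow ?B \<subseteq> Union ` Pow {W}"
      proof
        fix X assume X: "X \<in> Union ` Pow ?A \<inter> Union ` Pow ?B"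
        have XA: "X \<subseteq> W \<and> (\<forall>D\<in>?A. D \<inter> X \<noteq> {} \<longrightarrow> D \<subseteq> X)"
          by (rule iffD1[OF Union_Pow_iff[OF partAW]]) (rule IntD1[OF X])
        have XB: "X \<subseteq> W \<and> (\<forall>D\<in>?B. D \<inter> X \<noteq> {} \<longrightarrow> D \<subseteq> X)"
          by (rule iffD1[OF Union_Pow_iff[OF partBW]]) (rule IntD2[OF X])
        have A: "D \<subseteq> X" if "D \<in> A" "D \<inter> X \<noteq> {}" for D
          using that XA satA[OF that(1)] by blast
        have B: "D \<subseteq> X" if "D \<in> B" "D \<inter> X \<noteq> {}" for D
          using that XB satB[OF that(1)] by blast
        define g where "g v \<longleftrightarrow> v \<in> X" for v
        have "(g \<circ> Upper, g \<circ> Middle) \<in> colourings a"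
          unfolding colourings_def
        proof clarify
          fix D v w assume D: "D \<in> a" "v \<in> D" "w \<in> D"
          then have "v \<in> vertices n" "w \<in> vertices n" using block_subset[OF pa] by auto
          moreover have "lower_to_middle ` D \<in> A" using D(1) unfolding A_def by blast
          then have "lower_to_middle v \<in> X \<longleftrightarrow> lower_to_middle w \<in> X" using A D(2,3) by blast
          ultimately show "glue (g \<circ> Upper) (g \<circ> Middle) v = glue (g \<circ> Upper) (g \<circ> Middle) w"
            by (simp only: glue_a g_def)
        qed
        moreover have "(g \<circ> Middle, g \<circ> Lower) \<in> colourings b"
          unfolding colourings_def
        proof clarify
          fix D v w assume D: "D \<in> b" "v \<in> D" "w \<in> D"
          then have "v \<in> vertices n" "w \<in> vertices n" using block_subset[OF pb] by auto
          moreover have "upper_to_middle ` D \<in> B" using D(1) unfolding B_def by blast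
          then have "upper_to_middle v \<in> X \<longleftrightarrow> upper_to_middle w \<in> X" using B D(2,3) by blast
          ultimately show "glue (g \<circ> Middle) (g \<circ> Lower) v = glue (g \<circ> Middle) (g \<circ> Lower) w"
            by (simp only: glue_b g_def)
        qed
        ultimately have "g \<in> G" unfolding G_def by blast
        then have x_iff: "x \<in> X \<longleftrightarrow> v \<in> X" if "v \<in> W" for v
        proof -
          have "eqv x v" using that unfolding W_def by blast
          then have "g x = g v" using \<open>g \<in> G\<close> unfolding eqv_def by (rule bspec)
          then show ?thesis unfolding g_def .
        qed
        have "X = {} \<or> X = W"
        proof (cases "x \<in> X")
          case True
          have "W \<subseteq> X" by (rule subsetI) (use x_iff True in simp)
          then show ?thesis using XA by simp
        next
          case False
          then have "v \<notin> X" for v using x_iff XA by (cases "v \<in> W") auto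
          then show ?thesis by blast
        qed
        then show "X \<in> Union ` Pow {W}" by auto
      qed
    qed simp
    moreover have "card W + card (W \<inter> ?L) = 2 * card ?A"
      unfolding A_def
    proof (rule card_pad[OF part(1) inj(1) disj(1)])
      show "W \<subseteq> lower_to_middle ` vertices n \<union> ?L" using WV unfolding Va .
      show "card D = 2" if "D \<in> a" for D using a that by (simp add: brauer_def)
      show "D \<subseteq> W" if "D \<in> (image lower_to_middle) ` a \<union> (\<lambda>s. {s}) ` ?L" "D \<inter> W \<noteq> {}" for D using satA that unfolding A_def by blast
    qed simp_all
    moreover have "card W + card (W \<inter> ?U) = 2 * card ?B"
      unfolding B_def
    proof (rule card_pad[OF part(2) inj(2) disj(2)])
      show "W \<subseteq> upper_to_middle ` vertices n \<union> ?U" using WV unfolding Vb .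
      show "card D = 2" if "D \<in> b" for D using b that by (simp add: brauer_def)
      show "D \<subseteq> W" if "D \<in> (image upper_to_middle) ` b \<union> (\<lambda>s. {s}) ` ?U" "D \<inter> W \<noteq> {}" for D using satB that unfolding B_def by blast
    qed simp_all
    moreover have "K = (W \<inter> ?L) \<union> (W \<inter> ?U)"
    proof -
      have "K = W \<inter> vertices n"
        using eqv_block[OF K x] block_subset[OF product_in_partitions K]
        unfolding W_def V_def by blast
      then show ?thesis unfolding vertices_def by blast
    qed
    then have "card K = card (W \<inter> ?L) + card (W \<inter> ?U)"
      using finW by (simp only:) (rule card_Un_disjoint, auto)
    moreover have "card K > 0"
      using x finite_block[OF product_in_partitions K] by (auto simp: card_gt_0_iff)
    moreover have "card {W} = 1" by simp
    \<comment> \<open>Adding the two equations gives 2w + k = 2(p + q), which is at most 2w + 2.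
      Both l and u have the parity of w, so k is even.\<close>
    moreover have "k = 2"
      if "p + q \<le> w + s" "w + l = 2 * p" "w + u = 2 * q" "k = l + u" "k > 0" "s = 1" for p q w s l u k :: nat
      using that by presburger
    ultimately show ?thesis by blast
  qed
  then show ?thesis by (simp add: brauer_def)
qed

section \<open>Tightness for the Brauer monoid\<close>

lemma brauer_partitions: "a \<in> brauer n \<Longrightarrow> a \<in> partitions n"
  by (simp add: brauer_def)

lemma star_in_brauer: "a \<in> brauer n \<Longrightarrow> star a \<in> brauer n"
  using star_in_partitions[of a n] card_image[OF inj_on_subset[OF inj_flip subset_UNIV]]
  by (auto simp: brauer_def star_def)

text \<open>Every upper vertex lies either in a transversal, which contains one upper vertex, or in
  an upper hook, which contains two. Applied to \<open>star a\<close> as well, this shows that there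
  are as many lower hooks as upper ones.\<close>

lemma rank_count:
  assumes a: "a \<in> brauer n"
  shows "n = partition_rank a + 2 * card {B \<in> a. B \<subseteq> range Upper}"
proof -
  have pa: "a \<in> partitions n" using a by (rule brauer_partitions)
  have fin: "finite a" using pa by (rule finite_partition)
  have "card (Upper ` {1..n}) = card (\<Union>B\<in>a. B \<inter> range Upper)"
  proof -
    have "(\<Union>B\<in>a. B \<inter> range Upper) = vertices n \<inter> range Upper"
      using pa by (auto simp: partitions_def partition_on_def)
    also have "\<dots> = Upper ` {1..n}" by (auto simp: vertices_def)
    finally show ?thesis by simp
  qed
  also have "\<dots> = (\<Sum>B\<in>a. card (B \<inter> range Upper))"
  proof (rule card_UN_disjoint[OF fin])
    show "\<forall>B\<in>a. finite (B \<inter> range Upper)" using finite_block[OF pa] by blast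
    show "\<forall>B\<in>a. \<forall>C\<in>a. B \<noteq> C \<longrightarrow> (B \<inter> range Upper) \<inter> (C \<inter> range Upper) = {}"
      using block_eq[OF pa] by blast
  qed
  also have "\<dots> = (\<Sum>B\<in>a. of_bool (B \<in> transversals a) + 2 * of_bool (B \<subseteq> range Upper))"
  proof (rule sum.cong[OF refl])
    fix B assume B: "B \<in> a"
    then obtain v w where vw: "B = {v, w}" "v \<noteq> w" using a by (auto simp: brauer_def card_2_iff)
    have "v \<in> vertices n" "w \<in> vertices n" using block_subset[OF pa B] vw by auto
    then show "card (B \<inter> range Upper) = of_bool (B \<in> transversals a) + 2 * of_bool (B \<subseteq> range Upper)"
      using B vw(2) by (cases v; cases w) (auto simp: vw(1) transversals_def)
  qed
  also have "\<dots> = partition_rank a + 2 * card {B \<in> a. B \<subseteq> range Upper}"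
  proof -
    have "a \<inter> {B. B \<in> transversals a} = transversals a" unfolding transversals_def by auto
    moreover have "a \<inter> {B. B \<subseteq> range Upper} = {B \<in> a. B \<subseteq> range Upper}" by auto
    ultimately show ?thesis
      using fin by (simp add: sum.distrib sum_distrib_left[symmetric] partition_rank_def)
  qed
  finally show ?thesis by (simp add: card_image inj_on_def)
qed

text \<open>Replacing the hooks \<open>{x, y}\<close> and \<open>{i', j'}\<close> of \<open>a\<close> by transversals does not change the product
  \<open>ab\<close>, because the hook \<open>{i, j}\<close> of \<open>b\<close> still connects \<open>x\<close> and \<open>y\<close>.\<close>

lemma pull_hooks:
  assumes a: "a \<in> brauer n" and b: "b \<in> partitions n"
    and x: "{Upper x, Upper y} \<in> a" "x \<noteq> y" and i: "{Lower i, Lower j} \<in> a" "i \<noteq> j"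
    and ij: "{Upper i, Upper j} \<in> b"
    and a': "a' = (a - {{Upper x, Upper y}, {Lower i, Lower j}}) \<union> {{Upper x, Lower i}, {Upper y, Lower j}}"
  shows "a' \<in> brauer n" "partition_rank a' = partition_rank a + 2"
    "partition_product n a' b = partition_product n a b"
proof -
  let ?A = "{{Upper x, Upper y}, {Lower i, Lower j}}" and ?C = "{{Upper x, Lower i}, {Upper y, Lower j}}"
  have pa: "a \<in> partitions n" using a by (rule brauer_partitions)
  have "partition_on (\<Union>?A) ?C"
    using x(2) i(2) by (auto simp: partition_on_def disjoint_def)
  then have "partition_on (vertices n) a'"
    unfolding a' using pa x i by (intro partition_on_replace) (auto simp: partitions_def)
  then show a'B: "a' \<in> brauer n"
    using a unfolding brauer_def partitions_def a' by auto
  then have pa': "a' \<in> partitions n" by (rule brauer_partitions)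
  have "transversals a' = transversals a \<union> ?C"
    unfolding transversals_def a' by auto
  moreover have "transversals a \<inter> ?C = {}"
  proof -
    have "{Upper x, Lower i} \<noteq> {Upper x, Upper y}" "{Upper y, Lower j} \<noteq> {Upper x, Upper y}"
      by (auto simp: doubleton_eq_iff)
    then have "{Upper x, Lower i} \<notin> a" "{Upper y, Lower j} \<notin> a"
      using block_eq[OF pa x(1), of "{Upper x, Lower i}" "Upper x"]
        block_eq[OF pa x(1), of "{Upper y, Lower j}" "Upper y"] by auto
    then show ?thesis unfolding transversals_def by blast
  qed
  moreover have "card ?C = 2" using x(2) by (simp add: doubleton_eq_iff)
  ultimately show "partition_rank a' = partition_rank a + 2"
    unfolding partition_rank_def
    by (simp only: card_Un_disjoint[OF finite_transversals[OF pa]] finite.intros)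
  show "partition_product n a' b = partition_product n a b"
  proof (rule colourings_inject[of _ n])
    show "colourings (partition_product n a' b) = colourings (partition_product n a b)"
      unfolding colourings_product[OF pa b] colourings_product[OF pa' b]
    proof (intro equalityI subsetI; clarify)
      fix u l m assume um: "(u, m) \<in> colourings a'" and ml: "(m, l) \<in> colourings b"
      have m: "m i = m j" using colouringsD[OF ml ij, of "Upper i" "Upper j"] by simp
      moreover have "u x = m i" "u y = m j"
        using colouringsD[OF um, of "{Upper x, Lower i}" "Upper x" "Lower i"]
          colouringsD[OF um, of "{Upper y, Lower j}" "Upper y" "Lower j"] by (simp_all add: a')
      ultimately have u: "u x = u y" by simp
      have "(u, m) \<in> colourings a"
        unfolding colourings_def
      proof clarify
        fix B v w assume B: "B \<in> a" "v \<in> B" "w \<in> B"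
        then consider "B \<in> a'" | "B = {Upper x, Upper y}" | "B = {Lower i, Lower j}"
          unfolding a' by blast
        then show "glue u m v = glue u m w"
          using B(2,3) colouringsD[OF um _ B(2,3)] u m by cases auto
      qed
      then show "(u, l) \<in> colourings a O colourings b" using ml by blast
    next
      fix u l m assume um: "(u, m) \<in> colourings a" and ml: "(m, l) \<in> colourings b"
      have u: "u x = u y" using colouringsD[OF um x(1), of "Upper x" "Upper y"] by simp
      \<comment> \<open>In \<open>m\<close> the loop through \<open>i\<close> and \<open>j\<close>
        has a colour of its own; after the exchange it must have the common colour of
        \<open>x\<close> and \<open>y\<close>. Recolouring is harmless, since no other block of
        \<open>a\<close> or \<open>b\<close> contains these middle vertices.\<close>
      define m' where "m' = m(i := u x, j := u y)"
      have m': "m' i = u x" "m' j = u y" "\<And>k. k \<noteq> i \<Longrightarrow> k \<noteq> j \<Longrightarrow> m' k = m k"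
        using i(2) by (auto simp: m'_def)
      have "(u, m') \<in> colourings a'"
        unfolding colourings_def
      proof clarify
        fix B v w assume B: "B \<in> a'" "v \<in> B" "w \<in> B"
        then consider "B \<in> a" "B \<noteq> {Lower i, Lower j}" | "B = {Upper x, Lower i}" | "B = {Upper y, Lower j}"
          unfolding a' by blast
        then show "glue u m' v = glue u m' w"
        proof cases
          case 1
          have "glue u m' z = glue u m z" if "z \<in> B" for z
          proof (cases z)
            case (Lower k)
            then have "k \<noteq> i" "k \<noteq> j" using that 1 block_eq[OF pa 1(1) i(1)] by auto
            then show ?thesis using Lower m'(3) by simp
          qed (simp_all add: glue_def)
          then show ?thesis using colouringsD[OF um 1(1) B(2,3)] B(2,3) by simp
        qed (use B(2,3) m' in auto)
      qed
      moreover have "(m', l) \<in> colourings b"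
        unfolding colourings_def
      proof clarify
        fix B v w assume B: "B \<in> b" "v \<in> B" "w \<in> B"
        show "glue m' l v = glue m' l w"
        proof (cases "B = {Upper i, Upper j}")
          case True
          then show ?thesis using B(2,3) m'(1,2) u by auto
        next
          case False
          have "glue m' l z = glue m l z" if "z \<in> B" for z
          proof (cases z)
            case (Upper k)
            then have "k \<noteq> i" "k \<noteq> j" using that False block_eq[OF b B(1) ij] by auto
            then show ?thesis using Upper m'(3) by simp
          qed (simp_all add: glue_def)
          then show ?thesis using colouringsD[OF ml B] B(2,3) by simp
        qed
      qed
      ultimately show "(u, l) \<in> colourings a' O colourings b" by blast
    qed
  qed simp_all
qed

text \<open>Each exchange uses up an upper hook of \<open>a\<close>. One is always available while a
  lower hook is left, because \<open>rank_count\<close> for \<open>a\<close> and for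
  \<open>star a\<close> shows that the two kinds are equinumerous. The lower hooks over the rest of
  \<open>H\<close> survive the exchange, being disjoint from the blocks removed.\<close>

lemma pull_all_hooks:
  assumes b: "b \<in> brauer n" and "finite H" and a: "a \<in> brauer n"
    and H: "\<And>B. B \<in> H \<Longrightarrow> B \<in> b \<and> B \<subseteq> range Upper \<and> flip ` B \<in> a"
  shows "\<exists>a'\<in>brauer n. partition_product n a' b = partition_product n a b \<and>
    partition_rank a' = partition_rank a + 2 * card H"
  using assms(2-)
proof (induction H arbitrary: a)
  case empty
  then show ?case by auto
next
  case (insert h H)
  have pa: "a \<in> partitions n" and pb: "b \<in> partitions n"
    using insert.prems(1) b by (auto intro: brauer_partitions)
  have h: "h \<in> b" "h \<subseteq> range Upper" "flip ` h \<in> a" using insert.prems(2) by auto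
  then have "card h = 2" using b by (simp add: brauer_def)
  then obtain v w where "h = {v, w}" "v \<noteq> w" by (meson card_2_iff)
  then obtain i j where ij: "h = {Upper i, Upper j}" "i \<noteq> j" using h(2) by auto
  have low: "{Lower i, Lower j} \<in> a" using h(3) by (simp add: ij(1))
  have "h \<in> {B \<in> star a. B \<subseteq> range Upper}"
    using h(2,3) unfolding star_def by (auto intro: image_eqI[of _ _ "flip ` h"])
  then have "card {B \<in> star a. B \<subseteq> range Upper} > 0"
    using finite_partition[OF star_in_partitions[OF pa]] by (auto simp: card_gt_0_iff)
  then have "card {B \<in> a. B \<subseteq> range Upper} > 0"
    using rank_count[OF insert.prems(1)] rank_count[OF star_in_brauer[OF insert.prems(1)]] by simp
  then obtain B where B: "B \<in> a" "B \<subseteq> range Upper" by (auto simp: card_gt_0_iff)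
  then have "card B = 2" using insert.prems(1) by (simp add: brauer_def)
  then obtain v w where "B = {v, w}" "v \<noteq> w" by (meson card_2_iff)
  then obtain x y where xy: "B = {Upper x, Upper y}" "x \<noteq> y" using B(2) by auto
  define a' where "a' = (a - {{Upper x, Upper y}, {Lower i, Lower j}}) \<union> {{Upper x, Lower i}, {Upper y, Lower j}}"
  note a' = pull_hooks[OF insert.prems(1) pb B(1)[unfolded xy(1)] xy(2) low ij(2) h(1)[unfolded ij(1)] a'_def]
  have "C \<in> b \<and> C \<subseteq> range Upper \<and> flip ` C \<in> a'" if C: "C \<in> H" for C
  proof -
    have C': "C \<in> b" "C \<subseteq> range Upper" "flip ` C \<in> a" using insert.prems(2) C by auto
    have "flip ` C \<noteq> flip ` h" using C insert.hyps by (metis flip_image_flip)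
    moreover have "flip ` C \<noteq> {Upper x, Upper y}"
    proof
      assume "flip ` C = {Upper x, Upper y}"
      then have "flip ` flip ` C = {Lower x, Lower y}" by simp
      then show False using C'(2) by auto
    qed
    ultimately show ?thesis using C' unfolding a'_def by (simp add: ij(1))
  qed
  from insert.IH[OF a'(1) this] obtain a'' where "a'' \<in> brauer n"
    "partition_product n a'' b = partition_product n a' b"
    "partition_rank a'' = partition_rank a' + 2 * card H" by blast
  then show ?case using a'(2,3) insert.hyps by (intro bexI[of _ a'']) simp_all
qed

text \<open>No edge of the product graph leaves such a block: it can be coloured alone, with the
  upper and middle rows uncoloured. Applied with right factor \<open>star b\<close>, this supplies
  the lower hooks over the upper hooks of \<open>b\<close>.\<close>

lemma lower_block_of_product:
  assumes a: "a \<in> partitions n" and b: "b \<in> partitions n" and B: "B \<in> b" "B \<subseteq> range Lower"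
  shows "B \<in> partition_product n a b"
proof -
  obtain x where x: "x \<in> B" using block_nonempty[OF b B(1)] by blast
  then have xn: "x \<in> vertices n" using block_subset[OF b B(1)] by blast
  then obtain K where K: "K \<in> partition_product n a b" "x \<in> K"
    by (rule block_exists[OF product_in_partitions])
  have "K = B"
  proof
    show "B \<subseteq> K"
    proof
      fix y assume y: "y \<in> B"
      show "y \<in> K"
      proof (rule same_blockI[OF _ K])
        show "y \<in> vertices n" using y block_subset[OF b B(1)] by blast
        fix u l assume "(u, l) \<in> colourings (partition_product n a b)"
        then obtain m where "(m, l) \<in> colourings b" unfolding colourings_product[OF a b] by blast
        from colouringsD[OF this B(1) x y] show "glue u l x = glue u l y"
          using x y B(2) by auto
      qed simp
    qed
    have "(\<lambda>i. Upper i \<in> B, \<lambda>i. Lower i \<in> B) \<in> colourings b" by (rule block_colouring[OF b B(1)])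
    moreover have "(\<lambda>i. Upper i \<in> B) = (\<lambda>i. False)" using B(2) by auto
    moreover have "(\<lambda>i. False, \<lambda>i. False) \<in> colourings a"
      using indicator_colouring[OF a, of "{}"] by simp
    ultimately have col: "(\<lambda>i. Upper i \<in> B, \<lambda>i. Lower i \<in> B) \<in> colourings (partition_product n a b)"
      unfolding colourings_product[OF a b] by auto
    show "K \<subseteq> B"
    proof
      fix y assume y: "y \<in> K"
      then have "y \<in> vertices n" using K block_subset[OF product_in_partitions] by blast
      then show "y \<in> B" using colouringsD[OF col K y] x xn by (simp add: glue_indicator)
    qed
  qed
  then show ?thesis using K by simp
qed

text \<open>The witness is obtained from \<open>a b b\<^sup>*\<close>, all of whose lower hooks over upper hooks of \<open>b\<close> can be
  pulled up.\<close>

lemma brauer_left_witness: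
  assumes a: "a \<in> brauer n" and b: "b \<in> brauer n"
  shows "\<exists>a'\<in>brauer n. partition_product n a b = partition_product n a' b \<and>
    n + partition_rank (partition_product n a' b) = partition_rank a' + partition_rank b"
proof -
  have pa: "a \<in> partitions n" and pb: "b \<in> partitions n" and ps: "star b \<in> partitions n"
    using a b by (auto intro: brauer_partitions star_in_partitions)
  let ?ab = "partition_product n a b"
  let ?c = "partition_product n ?ab (star b)"
  let ?H = "{B \<in> b. B \<subseteq> range Upper}"
  have c: "?c \<in> brauer n" by (intro product_in_brauer star_in_brauer a b)
  have cb: "partition_product n ?c b = ?ab"
    using product_star_product[OF pb]
    by (simp add: product_assoc pa pb ps)
  \<comment> \<open>Multiplying \<open>ab\<close> by \<open>star b\<close> and then by
    \<open>b\<close> leads back to \<open>ab\<close>, so the rank cannot drop at either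
    step.\<close>
  have "partition_rank ?c \<le> partition_rank ?ab" by (rule rank_product_le_left) (simp_all add: ps)
  moreover have "partition_rank ?ab \<le> partition_rank ?c"
    using rank_product_le_left[of ?c n b] by (simp add: pb cb)
  ultimately have rank: "partition_rank ?c = partition_rank ?ab" by simp
  have "B \<in> b \<and> B \<subseteq> range Upper \<and> flip ` B \<in> ?c" if "B \<in> ?H" for B
  proof -
    have "flip ` B \<in> star b" using that unfolding star_def by blast
    moreover have "flip ` B \<subseteq> range Lower" using that flip_range(1) by blast
    ultimately show ?thesis using that lower_block_of_product[OF _ ps] by simp
  qed
  from pull_all_hooks[where H = ?H, OF b _ c this] obtain a' where a': "a' \<in> brauer n"
    "partition_product n a' b = partition_product n ?c b"
    "partition_rank a' = partition_rank ?c + 2 * card ?H"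
    using finite_partition[OF pb] by auto
  moreover have "n = partition_rank b + 2 * card ?H" by (rule rank_count[OF b])
  ultimately show ?thesis using cb rank by (intro bexI[of _ a']) simp_all
qed

text \<open>The left-hand witness for \<open>star b\<close> and \<open>star a\<close>, turned upside
  down.\<close>

lemma brauer_right_witness:
  assumes a: "a \<in> brauer n" and b: "b \<in> brauer n"
  shows "\<exists>b'\<in>brauer n. partition_product n a b = partition_product n a b' \<and>
    n + partition_rank (partition_product n a b') = partition_rank a + partition_rank b'"
proof -
  have pa: "a \<in> partitions n" and pb: "b \<in> partitions n" using a b by (auto intro: brauer_partitions)
  obtain c where c: "c \<in> brauer n"
    "partition_product n (star b) (star a) = partition_product n c (star a)"
    "n + partition_rank (partition_product n c (star a)) = partition_rank c + partition_rank (star a)"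
    using brauer_left_witness[OF star_in_brauer[OF b] star_in_brauer[OF a]] by blast
  have pc: "c \<in> partitions n" using c(1) by (rule brauer_partitions)
  have star_c: "partition_product n c (star a) = star (partition_product n a (star c))"
    by (simp add: star_product pa pc star_in_partitions)
  have "star (partition_product n a b) = star (partition_product n a (star c))"
    using c(2) by (simp only: star_c star_product[OF pa pb])
  then have "partition_product n a b = partition_product n a (star c)" by (metis star_star)
  then show ?thesis using c star_c star_in_brauer by (intro bexI[of _ "star c"]) simp_all
qed

lemma tight_brauer: "tight_twisting (brauer_monoid n) (rank_twisting n)"
proof -
  have zero: "rank_twisting n a b = 0"
    if "n + partition_rank (partition_product n a b) = partition_rank a + partition_rank b" for a b
    using that by (simp add: rank_twisting_def partition_monoid_def)
  have S: "carrier (brauer_monoid n) = brauer n" "monoid.mult (brauer_monoid n) = partition_product n"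
    by (simp_all add: brauer_monoid_def partition_monoid_def)
  have "twisting (brauer_monoid n) (rank_twisting n)"
    by (rule twisting_rank) (auto simp: S brauer_def)
  moreover have "\<exists>a'\<in>brauer n. partition_product n a b = partition_product n a' b \<and> rank_twisting n a' b = 0"
    if "a \<in> brauer n" "b \<in> brauer n" for a b
    using brauer_left_witness[OF that] zero by blast
  moreover have "\<exists>b'\<in>brauer n. partition_product n a b = partition_product n a b' \<and> rank_twisting n a b' = 0"
    if "a \<in> brauer n" "b \<in> brauer n" for a b
    using brauer_right_witness[OF that] zero by blast
  ultimately show ?thesis unfolding tight_twisting_def S by blast
qed

section \<open>Planar diagrams have no inversions\<close>

lemma position_simps [simp]:
  "position (Upper i) $ 1 = real i" "position (Upper i) $ 2 = 1"
  "position (Lower i) $ 1 = real i" "position (Lower i) $ 2 = 0"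
  by simp_all

lemma vec2_eq_iff: "(x :: real ^ 2) = y \<longleftrightarrow> x $ 1 = y $ 1 \<and> x $ 2 = y $ 2"
  by (simp add: vec_eq_iff forall_2)

lemma mem_cbox2:
  "z \<in> cbox (vector [a, b] :: real ^ 2) (vector [c, d]) \<longleftrightarrow> a \<le> z $ 1 \<and> z $ 1 \<le> c \<and> b \<le> z $ 2 \<and> z $ 2 \<le> d"
  by (auto simp: mem_box_cart forall_2)

lemma closed_segment2:
  fixes x y z :: "real ^ 2"
  assumes "z \<in> closed_segment x y"
  obtains t where "0 \<le> t" "t \<le> 1" "z $ 1 = (1 - t) * x $ 1 + t * y $ 1" "z $ 2 = (1 - t) * x $ 2 + t * y $ 2"
  using assms by (auto simp: in_segment)

lemma inj_on_position: "inj_on position (vertices n)"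
  unfolding inj_on_def vertices_def vec2_eq_iff by (auto simp del: position.simps)

text \<open>A path that leaves \<open>v\<close> stays inside its block, and \<open>w\<close> is the
  only other vertex there. So every graph representing \<open>a\<close> contains this edge.\<close>

lemma edge_in_graph:
  assumes E: "graph_of_partition n a E" and B: "{v, w} \<in> a" "v \<noteq> w"
  shows "{v, w} \<in> E"
proof -
  let ?A = "{(u, v). {u, v} \<in> E}"
  have "{v, w} \<in> vertices n // connection (vertices n) E"
    using E B by (auto simp: graph_of_partition_def components_on_def)
  then have vw: "(v, w) \<in> connection (vertices n) E" and v: "v \<in> vertices n"
    and comp: "\<And>z. (v, z) \<in> connection (vertices n) E \<Longrightarrow> z \<in> {v, w}"
    using quotient_eq_iff[OF equiv_connection, of "{v, w}" "vertices n" E "{v, w}" v w]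
      in_quotient_imp_closed[OF equiv_connection, of "{v, w}" "vertices n" E v]
      in_quotient_imp_subset[OF equiv_connection, of "{v, w}" "vertices n" E] by blast+
  from vw B(2) obtain z where z: "{v, z} \<in> E"
    by (auto simp: connection_def elim: converse_rtranclE)
  then have "card {v, z} = 2" "z \<in> vertices n"
    using E by (auto simp: graph_of_partition_def graph_on_def)
  then have "(v, z) \<in> connection (vertices n) E" "z \<noteq> v" using z v by (auto simp: connection_def)
  then have "z = w" using comp by blast
  then show ?thesis using z by simp
qed

text \<open>Drawings leave the direction of an arc open, whereas the crossing argument joins further
  pieces to its ends and needs a definite direction.\<close>

lemma drawn_edge:
  assumes "crossing_free_drawing n E \<gamma>" "{v, w} \<in> E"
  obtains p where "path p" "pathstart p = position w" "pathfinish p = position v"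
    "path_image p = path_image (\<gamma> {v, w})"
proof -
  have arc: "arc (\<gamma> {v, w})"
    and ends: "{pathstart (\<gamma> {v, w}), pathfinish (\<gamma> {v, w})} = {position v, position w}"
    using assms unfolding crossing_free_drawing_def by auto
  show thesis
  proof (cases "pathstart (\<gamma> {v, w}) = position w")
    case True
    moreover from this have "pathfinish (\<gamma> {v, w}) = position v"
      using ends by (auto simp: doubleton_eq_iff)
    ultimately show ?thesis using that[of "\<gamma> {v, w}"] arc by (auto simp: arc_imp_path)
  next
    case False
    then have "pathstart (\<gamma> {v, w}) = position v" "pathfinish (\<gamma> {v, w}) = position w"
      using ends by (auto simp: doubleton_eq_iff)
    then show ?thesis using that[of "reversepath (\<gamma> {v, w})"] arc by (auto simp: arc_imp_path)
  qed
qed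

text \<open>Both drawings are prolonged beyond the rectangle, the first one vertically up and down, the
  second one to the upper right and lower left corner of a larger rectangle.\<close>

lemma planar_no_crossing:
  assumes "planar n a" and e: "{Upper i, Lower s} \<in> a" and f: "{Upper j, Lower t} \<in> a"
    and ij: "i < j" and ts: "t < s"
  shows False
proof -
  obtain E \<gamma> where E: "graph_of_partition n a E" and \<gamma>: "crossing_free_drawing n E \<gamma>"
    using assms(1) by (auto simp: planar_def)
  let ?e = "{Upper i, Lower s}" and ?f = "{Upper j, Lower t}"
  have eE: "?e \<in> E" and fE: "?f \<in> E" using edge_in_graph[OF E] e f by auto
  have esub: "?e \<subseteq> vertices n" and fsub: "?f \<subseteq> vertices n"
    using E eE fE unfolding graph_of_partition_def graph_on_def by blast+
  then have bounds: "i \<in> {1..n}" "s \<in> {1..n}" "j \<in> {1..n}" "t \<in> {1..n}" by auto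
  obtain p where p: "path p" "pathstart p = position (Lower s)" "pathfinish p = position (Upper i)"
    "path_image p = path_image (\<gamma> ?e)" using drawn_edge[OF \<gamma> eE] by blast
  obtain q where q: "path q" "pathstart q = position (Lower t)" "pathfinish q = position (Upper j)"
    "path_image q = path_image (\<gamma> ?f)" using drawn_edge[OF \<gamma> fE] by blast
  have drawn: "path_image (\<gamma> d) \<subseteq> cbox (vector [1, 0]) (vector [real n, 1])"
    "path_image (\<gamma> d) \<inter> position ` vertices n = position ` d" if "d \<in> E" for d
    using \<gamma> that unfolding crossing_free_drawing_def by simp_all
  have box: "path_image p \<subseteq> cbox (vector [1, 0]) (vector [real n, 1])"
    "path_image q \<subseteq> cbox (vector [1, 0]) (vector [real n, 1])"
    using drawn(1)[OF eE] drawn(1)[OF fE] unfolding p(4) q(4) .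
  have avoid: "v \<in> d" if "d \<in> E" "d \<subseteq> vertices n" "v \<in> vertices n" "position v \<in> path_image (\<gamma> d)" for d v
    using drawn(2)[OF that(1)] that(2-4) inj_on_image_mem_iff[OF inj_on_position] by blast
  have meet: "path_image (\<gamma> d) \<inter> path_image (\<gamma> d') \<subseteq> position ` (d \<inter> d')"
    if "d \<in> E" "d' \<in> E" "d \<noteq> d'" for d d'
    using \<gamma> that unfolding crossing_free_drawing_def by simp
  have "?e \<noteq> ?f" and ef: "?e \<inter> ?f = {}" using ij ts by (auto simp: doubleton_eq_iff)
  then have "path_image p \<inter> path_image q \<subseteq> position ` (?e \<inter> ?f)"
    unfolding p(4) q(4) by (intro meet eE fE)
  then have disj: "path_image p \<inter> path_image q = {}" unfolding ef by simp
  have pq: "0 \<le> z $ 2" "z $ 2 \<le> 1" if "z \<in> path_image p \<union> path_image q" for z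
    using that box by (auto simp: mem_cbox2 subset_iff)
  have no: "position (Lower t) \<notin> path_image p" "position (Upper j) \<notin> path_image p"
    "position (Lower s) \<notin> path_image q" "position (Upper i) \<notin> path_image q"
    unfolding p(4) q(4)
    using avoid[OF eE esub, of "Lower t"] avoid[OF eE esub, of "Upper j"]
      avoid[OF fE fsub, of "Lower s"] avoid[OF fE fsub, of "Upper i"] bounds ij ts
    by (simp_all del: position.simps) auto
  \<comment> \<open>The pieces lie below height 0 or above height 1, in the rectangle from (0, -1)
    to (n + 1, 2). \<open>V1\<close> and \<open>H1\<close> are kept apart by \<open>t < s\<close>,
    and \<open>V3\<close> and \<open>H3\<close> by \<open>i < j\<close>.\<close>
  define V1 where "V1 = linepath (vector [real s, -1] :: real ^ 2) (position (Lower s))"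
  define V3 where "V3 = linepath (position (Upper i)) (vector [real i, 2] :: real ^ 2)"
  define H1 where "H1 = linepath (vector [0, -1] :: real ^ 2) (position (Lower t))"
  define H3 where "H3 = linepath (position (Upper j)) (vector [real n + 1, 2] :: real ^ 2)"
  have V1: "z $ 1 = real s" "z $ 2 \<le> 0" if "z \<in> path_image V1" for z
    using that by (auto simp: V1_def algebra_simps elim!: closed_segment2)
  have V3: "z $ 1 = real i" "z $ 2 \<ge> 1" if "z \<in> path_image V3" for z
    using that by (auto simp: V3_def algebra_simps elim!: closed_segment2)
  have H1: "z $ 1 \<le> real t" "z $ 2 \<le> 0" "z $ 2 = 0 \<Longrightarrow> z $ 1 = real t" if "z \<in> path_image H1" for z
    using that by (auto simp: H1_def algebra_simps mult_left_le_one_le elim!: closed_segment2)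
  have H3: "z $ 1 \<ge> real j" "z $ 2 \<ge> 1" "z $ 2 = 1 \<Longrightarrow> z $ 1 = real j" if "z \<in> path_image H3" for z
  proof -
    from that obtain \<tau> where \<tau>: "0 \<le> \<tau>" "z $ 1 = (1 - \<tau>) * real j + \<tau> * (real n + 1)"
      "z $ 2 = (1 - \<tau>) * 1 + \<tau> * 2" by (auto simp: H3_def elim!: closed_segment2)
    have "z $ 1 = real j + \<tau> * (real n + 1 - real j)" using \<tau> by (simp add: algebra_simps)
    then show "z $ 1 \<ge> real j" "z $ 2 \<ge> 1" "z $ 2 = 1 \<Longrightarrow> z $ 1 = real j"
      using \<tau> bounds by auto
  qed
  let ?V = "V1 +++ p +++ V3" and ?H = "H1 +++ q +++ H3"
  let ?a = "vector [0, -1] :: real ^ 2" and ?b = "vector [real n + 1, 2] :: real ^ 2"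
  have ends: "pathfinish V1 = pathstart p" "pathfinish p = pathstart V3"
    "pathfinish H1 = pathstart q" "pathfinish q = pathstart H3"
    by (simp_all add: V1_def V3_def H1_def H3_def p q)
  have paths: "path V1" "path V3" "path H1" "path H3"
    by (simp_all add: V1_def V3_def H1_def H3_def)
  have image: "path_image ?V = path_image V1 \<union> (path_image p \<union> path_image V3)"
    "path_image ?H = path_image H1 \<union> (path_image q \<union> path_image H3)"
    using ends by (simp_all add: path_image_join)
  have seg: "closed_segment x y \<subseteq> cbox ?a ?b" if "x \<in> cbox ?a ?b" "y \<in> cbox ?a ?b" for x y
    using that by (simp add: closed_segment_subset)
  have big: "path_image p \<subseteq> cbox ?a ?b" "path_image q \<subseteq> cbox ?a ?b"
    using box by (auto simp: mem_cbox2 subset_iff)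
  have segs: "path_image V1 \<subseteq> cbox ?a ?b" "path_image V3 \<subseteq> cbox ?a ?b"
    "path_image H1 \<subseteq> cbox ?a ?b" "path_image H3 \<subseteq> cbox ?a ?b"
    unfolding V1_def V3_def H1_def H3_def path_image_linepath
    by (rule seg; use bounds in \<open>simp del: position.simps add: mem_cbox2\<close>)+
  obtain z where z: "z \<in> path_image ?H" "z \<in> path_image ?V"
  proof (rule fashoda[of ?H ?V ?a ?b])
    show "path ?H" "path ?V" using ends paths p(1) q(1) by simp_all
    show "path_image ?H \<subseteq> cbox ?a ?b" "path_image ?V \<subseteq> cbox ?a ?b"
      unfolding image by (intro Un_least big segs)+
    show "pathstart ?H $ 1 = ?a $ 1" "pathfinish ?H $ 1 = ?b $ 1"
      "pathstart ?V $ 2 = ?a $ 2" "pathfinish ?V $ 2 = ?b $ 2"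
      by (simp_all add: V1_def V3_def H1_def H3_def)
  qed
  \<comment> \<open>A prolongation can meet a drawn path only at height 0 or 1. There it has only
    its own vertex, and the other path avoids that vertex.\<close>
  from z consider
    "z \<in> path_image H1" "z \<in> path_image V1" | "z \<in> path_image H1" "z \<in> path_image p" |
    "z \<in> path_image H1" "z \<in> path_image V3" | "z \<in> path_image q" "z \<in> path_image V1" |
    "z \<in> path_image q" "z \<in> path_image p" | "z \<in> path_image q" "z \<in> path_image V3" |
    "z \<in> path_image H3" "z \<in> path_image V1" | "z \<in> path_image H3" "z \<in> path_image p" |
    "z \<in> path_image H3" "z \<in> path_image V3" unfolding image by blast
  then show False
  proof cases
    case 1
    then show ?thesis using H1(1) V1(1) ts by fastforce
  next
    case 2
    then have "z $ 2 = 0" using H1(2) pq(1) by fastforce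
    then have "z = position (Lower t)" using H1(3)[OF 2(1)] by (simp only: vec2_eq_iff position_simps)
    then show ?thesis using 2 no by blast
  next
    case 3
    then show ?thesis using H1(2) V3(2) by fastforce
  next
    case 4
    then have "z $ 2 = 0" using V1(2) pq(1) by fastforce
    then have "z = position (Lower s)" using V1(1)[OF 4(2)] by (simp only: vec2_eq_iff position_simps)
    then show ?thesis using 4 no by blast
  next
    case 5
    then show ?thesis using disj by blast
  next
    case 6
    then have "z $ 2 = 1" using V3(2) pq(2) by fastforce
    then have "z = position (Upper i)" using V3(1)[OF 6(2)] by (simp only: vec2_eq_iff position_simps)
    then show ?thesis using 6 no by blast
  next
    case 7
    then show ?thesis using H3(2) V1(2) by fastforce
  next
    case 8
    then have "z $ 2 = 1" using H3(2) pq(2) by fastforce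
    then have "z = position (Upper j)" using H3(3)[OF 8(1)] by (simp only: vec2_eq_iff position_simps)
    then show ?thesis using 8 no by blast
  next
    case 9
    then show ?thesis using H3(1) V3(1) ij by fastforce
  qed
qed

section \<open>Drawings with straight edges\<close>

text \<open>Vertical strands and segments between horizontal neighbours, drawn straight, meet only
  in common ends. All planar diagrams constructed below are represented by subgraphs of this one
  graph.\<close>

definition ladder :: "nat \<Rightarrow> vertex set set" where
  "ladder n = {{Upper i, Lower i} | i. i \<in> {1..n}}
    \<union> {{Upper i, Upper (Suc i)} | i. i \<in> {1..<n}} \<union> {{Lower i, Lower (Suc i)} | i. i \<in> {1..<n}}"

lemma ladder_cases:
  assumes "e \<in> ladder n"
  obtains (strand) i where "e = {Upper i, Lower i}" "i \<in> {1..n}"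
  | (upper) i where "e = {Upper i, Upper (Suc i)}" "i \<in> {1..<n}"
  | (lower) i where "e = {Lower i, Lower (Suc i)}" "i \<in> {1..<n}"
  using assms by (auto simp: ladder_def)

lemma ladder_edge:
  assumes "e \<in> ladder n"
  obtains v w where "e = {v, w}" "v \<noteq> w" "v \<in> vertices n" "w \<in> vertices n"
  using assms by (cases rule: ladder_cases) auto

text \<open>An edge is an unordered pair, so its segment is expressed as a convex hull, for which
  the order of the ends is irrelevant.\<close>

lemma ladder_segment:
  assumes "z \<in> convex hull (position ` e)"
  shows "e = {Upper i, Lower i} \<Longrightarrow> z $ 1 = real i \<and> 0 \<le> z $ 2 \<and> z $ 2 \<le> 1"
    and "e = {Upper i, Upper (Suc i)} \<Longrightarrow> real i \<le> z $ 1 \<and> z $ 1 \<le> real (Suc i) \<and> z $ 2 = 1"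
    and "e = {Lower i, Lower (Suc i)} \<Longrightarrow> real i \<le> z $ 1 \<and> z $ 1 \<le> real (Suc i) \<and> z $ 2 = 0"
  using assms
  by (auto simp del: position.simps simp: segment_convex_hull[symmetric] algebra_simps elim!: closed_segment2)

lemma ladder_crossing_free:
  assumes e: "e \<in> ladder n" and f: "f \<in> ladder n" and "e \<noteq> f"
    and z: "z \<in> convex hull (position ` e)" "z \<in> convex hull (position ` f)"
  shows "z \<in> position ` (e \<inter> f)"
proof -
  have *: "z \<in> position ` (e \<inter> f)" if "v \<in> e" "v \<in> f" "z $ 1 = position v $ 1" "z $ 2 = position v $ 2" for v
    using that by (auto simp: vec2_eq_iff)
  show ?thesis
    using e
  proof (cases rule: ladder_cases)
    case (strand i)
    note zi = ladder_segment(1)[OF z(1) strand(1)]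
    from f show ?thesis
    proof (cases rule: ladder_cases)
      case (strand j)
      then show ?thesis using zi ladder_segment(1)[OF z(2) strand(1)] \<open>e \<noteq> f\<close> \<open>e = {Upper i, Lower i}\<close> by auto
    next
      case (upper j)
      then have "i = j \<or> i = Suc j" using zi ladder_segment(2)[OF z(2) upper(1)] by auto
      then show ?thesis using zi ladder_segment(2)[OF z(2) upper(1)]
        by (intro *[of "Upper i"]) (auto simp: strand upper)
    next
      case (lower j)
      then have "i = j \<or> i = Suc j" using zi ladder_segment(3)[OF z(2) lower(1)] by auto
      then show ?thesis using zi ladder_segment(3)[OF z(2) lower(1)]
        by (intro *[of "Lower i"]) (auto simp: strand lower)
    qed
  next
    case (upper i)
    note zi = ladder_segment(2)[OF z(1) upper(1)]
    from f show ?thesis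
    proof (cases rule: ladder_cases)
      case (strand j)
      then have "j = i \<or> j = Suc i" using zi ladder_segment(1)[OF z(2) strand(1)] by auto
      then show ?thesis using zi ladder_segment(1)[OF z(2) strand(1)]
        by (intro *[of "Upper j"]) (auto simp: strand upper)
    next
      case (upper j)
      note zj = ladder_segment(2)[OF z(2) upper(1)]
      have "i \<noteq> j" using \<open>e \<noteq> f\<close> upper \<open>e = {Upper i, Upper (Suc i)}\<close> by auto
      then consider "j = Suc i" "z $ 1 = real j" | "i = Suc j" "z $ 1 = real i" using zi zj by fastforce
      then show ?thesis
        using zi by cases (intro *[of "Upper j"] *[of "Upper i"]; simp add: upper \<open>e = {Upper i, Upper (Suc i)}\<close>)+
    next
      case (lower j)
      then show ?thesis using zi ladder_segment(3)[OF z(2) lower(1)] by auto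
    qed
  next
    case (lower i)
    note zi = ladder_segment(3)[OF z(1) lower(1)]
    from f show ?thesis
    proof (cases rule: ladder_cases)
      case (strand j)
      then have "j = i \<or> j = Suc i" using zi ladder_segment(1)[OF z(2) strand(1)] by auto
      then show ?thesis using zi ladder_segment(1)[OF z(2) strand(1)]
        by (intro *[of "Lower j"]) (auto simp: strand lower)
    next
      case (upper j)
      then show ?thesis using zi ladder_segment(2)[OF z(2) upper(1)] by auto
    next
      case (lower j)
      note zj = ladder_segment(3)[OF z(2) lower(1)]
      have "i \<noteq> j" using \<open>e \<noteq> f\<close> lower \<open>e = {Lower i, Lower (Suc i)}\<close> by auto
      then consider "j = Suc i" "z $ 1 = real j" | "i = Suc j" "z $ 1 = real i" using zi zj by fastforce
      then show ?thesis
        using zi by cases (intro *[of "Lower j"] *[of "Lower i"]; simp add: lower \<open>e = {Lower i, Lower (Suc i)}\<close>)+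
    qed
  qed
qed

lemma ladder_avoids_vertices:
  assumes e: "e \<in> ladder n" and v: "v \<in> vertices n" and z: "position v \<in> convex hull (position ` e)"
  shows "v \<in> e"
  using e
proof (cases rule: ladder_cases)
  case (strand i)
  then show ?thesis using ladder_segment(1)[OF z strand(1)] v by (cases v) auto
next
  case (upper i)
  then show ?thesis using ladder_segment(2)[OF z upper(1)] v by (cases v) auto
next
  case (lower i)
  then show ?thesis using ladder_segment(3)[OF z lower(1)] v by (cases v) auto
qed

text \<open>A graph with the same colourings as \<open>a\<close> has the blocks of \<open>a\<close>
  as components, so planarity becomes a comparison of colourings.\<close>

lemma planar_ladder:
  assumes a: "a \<in> partitions n" and E: "E \<subseteq> ladder n" and col: "colourings a = colourings E"
  shows "planar n a"
proof -
  have graph: "graph_on (vertices n) E"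
    unfolding graph_on_def
  proof
    fix e assume "e \<in> E"
    then obtain v w where "e = {v, w}" "v \<noteq> w" "v \<in> vertices n" "w \<in> vertices n"
      using E ladder_edge by blast
    then show "e \<subseteq> vertices n \<and> card e = 2" by simp
  qed
  have "components_on (vertices n) E = a"
  proof (rule colourings_inject[OF partitions_components_on a])
    show "colourings (components_on (vertices n) E) = colourings a"
      by (simp only: colourings_components_on[OF graph] col colourings_def[of E])
  qed
  with graph have "graph_of_partition n a E" by (simp add: graph_of_partition_def)
  moreover
  have "\<exists>\<gamma>. arc \<gamma> \<and> {pathstart \<gamma>, pathfinish \<gamma>} = position ` e \<and> path_image \<gamma> = convex hull (position ` e)"
    if e: "e \<in> E" for e
  proof -
    obtain v w where vw: "e = {v, w}" "v \<noteq> w" "v \<in> vertices n" "w \<in> vertices n"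
      using e E ladder_edge by blast
    have "position v \<noteq> position w" using vw(2-4) by (cases v; cases w) (auto simp: vec2_eq_iff)
    then show ?thesis
      by (intro exI[of _ "linepath (position v) (position w)"])
        (simp add: vw(1) arc_linepath segment_convex_hull)
  qed
  then obtain \<gamma> where \<gamma>: "\<And>e. e \<in> E \<Longrightarrow> arc (\<gamma> e) \<and> {pathstart (\<gamma> e), pathfinish (\<gamma> e)} = position ` e \<and>
      path_image (\<gamma> e) = convex hull (position ` e)" by metis
  have "crossing_free_drawing n E \<gamma>"
    unfolding crossing_free_drawing_def
  proof (intro conjI ballI impI)
    fix e assume e: "e \<in> E"
    show "arc (\<gamma> e)" "{pathstart (\<gamma> e), pathfinish (\<gamma> e)} = position ` e" using \<gamma>[OF e] by blast+
    have "e \<subseteq> vertices n" using graph e by (simp add: graph_on_def)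
    have "position ` e \<subseteq> cbox (vector [1, 0]) (vector [real n, 1])"
    proof clarify
      fix v assume "v \<in> e"
      then have "v \<in> vertices n" using \<open>e \<subseteq> vertices n\<close> by blast
      then show "position v \<in> cbox (vector [1, 0]) (vector [real n, 1])"
        by (cases v) (auto simp: mem_cbox2)
    qed
    then show "path_image (\<gamma> e) \<subseteq> cbox (vector [1, 0]) (vector [real n, 1])"
      using \<gamma>[OF e] hull_minimal[of "position ` e" _ convex] by simp
    show "path_image (\<gamma> e) \<inter> position ` vertices n = position ` e"
      using \<gamma>[OF e] \<open>e \<subseteq> vertices n\<close> ladder_avoids_vertices[of e n] e E hull_subset[of "position ` e" convex]
      by blast
  next
    fix e f assume ef: "e \<in> E" "f \<in> E" "e \<noteq> f"
    show "path_image (\<gamma> e) \<inter> path_image (\<gamma> f) \<subseteq> position ` (e \<inter> f)"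
    proof
      fix z assume "z \<in> path_image (\<gamma> e) \<inter> path_image (\<gamma> f)"
      then have "z \<in> convex hull (position ` e)" "z \<in> convex hull (position ` f)"
        using \<gamma>[OF ef(1)] \<gamma>[OF ef(2)] by auto
      then show "z \<in> position ` (e \<inter> f)"
        using ef E by (intro ladder_crossing_free[of e n f]) auto
    qed
  qed
  ultimately show ?thesis unfolding planar_def by blast
qed

section \<open>Diagrams that agree with the identity off a few columns\<close>

text \<open>The part of the identity on the columns \<open>I\<close>. Each concrete diagram below is
  a small piece on columns \<open>K\<close> completed by the strands on the others.\<close>

definition strands :: "nat set \<Rightarrow> vertex set set" where
  "strands I = (\<lambda>i. {Upper i, Lower i}) ` I"

lemma colourings_Un: "colourings (X \<union> Y) = colourings X \<inter> colourings Y"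
  by (auto simp: colourings_def)

lemma colourings_empty: "colourings {} = UNIV"
  by (simp add: colourings_def)

lemma colourings_insert:
  "(u, l) \<in> colourings (insert B X) \<longleftrightarrow>
    (\<forall>x\<in>B. \<forall>y\<in>B. glue u l x = glue u l y) \<and> (u, l) \<in> colourings X"
  by (simp add: colourings_def)

lemma colourings_eqI:
  assumes "\<And>u l. (u, l) \<in> colourings X \<longleftrightarrow> (u, l) \<in> colourings Y"
  shows "colourings X = colourings Y"
  using assms by (simp add: set_eq_iff split_paired_All)

lemma colourings_strands: "(u, l) \<in> colourings (strands I) \<longleftrightarrow> (\<forall>i\<in>I. u i = l i)"
  by (auto simp: colourings_def strands_def)

lemma partition_strands:
  assumes K: "K \<subseteq> {1..n}" and X: "partition_on (Upper ` K \<union> Lower ` K) X"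
  shows "X \<union> strands ({1..n} - K) \<in> partitions n"
proof -
  let ?I = "{1..n} - K"
  have "partition_on (Upper ` ?I \<union> Lower ` ?I) (strands ?I)"
    by (auto simp: partition_on_def disjoint_def strands_def)
  then have "partition_on ((Upper ` K \<union> Lower ` K) \<union> (Upper ` ?I \<union> Lower ` ?I)) (X \<union> strands ?I)"
    by (rule partition_on_Un[OF X]) auto
  moreover have "(Upper ` K \<union> Lower ` K) \<union> (Upper ` ?I \<union> Lower ` ?I) = vertices n"
    using K by (auto simp: vertices_def)
  ultimately show ?thesis by (simp add: partitions_def)
qed

lemma rank_strands:
  assumes K: "K \<subseteq> {1..n}" and X: "partition_on (Upper ` K \<union> Lower ` K) X"
  shows "partition_rank (X \<union> strands ({1..n} - K)) = partition_rank X + (n - card K)"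
proof -
  let ?I = "{1..n} - K"
  have fin: "finite K" using K by (rule finite_subset) simp
  then have finX: "finite X" by (intro finite_elements[OF _ X]) simp
  have "transversals (X \<union> strands ?I) = transversals X \<union> strands ?I"
    by (auto simp: transversals_def strands_def)
  moreover have "transversals X \<inter> strands ?I = {}"
    using partition_onD1[OF X] by (auto simp: transversals_def strands_def)
  moreover have "card (strands ?I) = n - card K"
    using K fin by (simp add: strands_def card_image inj_on_def doubleton_eq_iff card_Diff_subset)
  moreover have "finite (strands ?I)" "finite (transversals X)"
    using finX by (simp_all add: strands_def transversals_def)
  ultimately show ?thesis by (simp add: partition_rank_def card_Un_disjoint)
qed

text \<open>Only the small piece \<open>X\<close> needs a ladder graph \<open>F\<close> of its own.
  It may differ from \<open>X\<close>: singletons give no edge, and a block of three vertices gives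
  two.\<close>

lemma planar_strands:
  assumes "K \<subseteq> {1..n}" "partition_on (Upper ` K \<union> Lower ` K) X"
    and "F \<subseteq> ladder n" "colourings F = colourings X"
  shows "X \<union> strands ({1..n} - K) \<in> planar_partitions n"
proof -
  have "strands ({1..n} - K) \<subseteq> ladder n" by (auto simp: strands_def ladder_def)
  then have "planar n (X \<union> strands ({1..n} - K))"
    using assms(3,4)
    by (intro planar_ladder[of _ n "F \<union> strands ({1..n} - K)"] partition_strands assms)
      (simp_all add: colourings_Un)
  then show ?thesis using partition_strands[OF assms(1,2)] by (simp add: planar_partitions_def)
qed

lemma transversals_empty [simp]: "transversals {} = {}"
  by (simp add: transversals_def)

lemma transversals_insert:
  "transversals (insert B X) = (if B \<inter> range Upper \<noteq> {} \<and> B \<inter> range Lower \<noteq> {}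
    then insert B (transversals X) else transversals X)"
  by (auto simp: transversals_def)

lemma card_strand: "B \<in> strands I \<Longrightarrow> card B = 2"
  by (auto simp: strands_def)

section \<open>Rank bounds and looseness\<close>

lemma rank_le_card:
  assumes "a \<in> partitions n" "finite I" "\<And>T. T \<in> transversals a \<Longrightarrow> \<exists>i\<in>I. Upper i \<in> T"
  shows "partition_rank a \<le> card I"
  unfolding partition_rank_def
proof (rule card_le_if_inj_on_rel[where r = "\<lambda>T i. Upper i \<in> T"])
  fix T T' i assume "T \<in> transversals a" "T' \<in> transversals a" "Upper i \<in> T" "Upper i \<in> T'"
  then show "T = T'" using block_eq[OF assms(1), of T T'] by (simp add: transversals_def)
qed (use assms in auto)

text \<open>A transversal through the upper vertex 2 also passes through 1, so 2 is dispensable as a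
  representative. If blocks have at most two elements, then \<open>B\<close> is the hook on 1 and 2,
  and no transversal uses either vertex.\<close>

lemma rank_le_connected:
  assumes a: "a \<in> partitions n" and B: "B \<in> a" "Upper 1 \<in> B" "Upper 2 \<in> B" and "n \<ge> 2"
  shows "partition_rank a \<le> n - 1"
    and "a \<in> partial_brauer n \<Longrightarrow> partition_rank a \<le> n - 2"
proof -
  have upper: "\<exists>i\<in>{1..n}. Upper i \<in> T" if "T \<in> transversals a" for T
    using that block_subset[OF a, of T] by (auto simp: transversals_def)
  have B_eq: "T = B" if "T \<in> a" "Upper 1 \<in> T \<or> Upper 2 \<in> T" for T
    using that block_eq[OF a that(1) B(1)] B by blast
  have "partition_rank a \<le> card ({1..n} - {2})"
  proof (rule rank_le_card[OF a])
    fix T assume T: "T \<in> transversals a"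
    then obtain i where i: "i \<in> {1..n}" "Upper i \<in> T" using upper by blast
    show "\<exists>i\<in>{1..n} - {2}. Upper i \<in> T"
    proof (cases "i = 2")
      case True
      then have "Upper 1 \<in> T" using i T B_eq[of T] B by (simp add: transversals_def)
      then show ?thesis using \<open>n \<ge> 2\<close> by (intro bexI[of _ 1]) auto
    qed (use i in auto)
  qed simp
  then show "partition_rank a \<le> n - 1" using \<open>n \<ge> 2\<close> by simp
  assume "a \<in> partial_brauer n"
  then have "card B \<le> 2" using B by (simp add: partial_brauer_def)
  then have B_is: "B = {Upper 1, Upper 2}"
    using B finite_block[OF a B(1)] card_seteq[of B "{Upper 1, Upper 2}"] by auto
  have "partition_rank a \<le> card ({1..n} - {1, 2})"
  proof (rule rank_le_card[OF a])
    fix T assume T: "T \<in> transversals a"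
    then obtain i where i: "i \<in> {1..n}" "Upper i \<in> T" using upper by blast
    have "T \<noteq> B" using T by (auto simp: B_is transversals_def)
    then have "i \<noteq> 1" "i \<noteq> 2" using i T B_eq[of T] by (auto simp: transversals_def)
    then show "\<exists>i\<in>{1..n} - {1, 2}. Upper i \<in> T" using i by blast
  qed simp
  also have "card ({1..n} - {1, 2}) = n - 2" using \<open>n \<ge> 2\<close> by (simp add: card_Diff_subset)
  finally show "partition_rank a \<le> n - 2" .
qed

lemma loose_twistingI:
  assumes S: "carrier S \<subseteq> partitions n" "monoid.mult S = partition_product n"
    and ab: "a \<in> carrier S" "b \<in> carrier S"
    and no: "\<And>a'. a' \<in> carrier S \<Longrightarrow> partition_product n a b = partition_product n a' b \<Longrightarrow>
      n + partition_rank (partition_product n a b) \<noteq> partition_rank a' + partition_rank b"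
  shows "loose_twisting S (rank_twisting n)"
proof -
  have "\<not> tight_twisting S (rank_twisting n)"
  proof
    assume "tight_twisting S (rank_twisting n)"
    then obtain a' where a': "a' \<in> carrier S" "partition_product n a b = partition_product n a' b"
      "rank_twisting n a' b = 0" using ab unfolding tight_twisting_def S(2) by blast
    then have "n + partition_rank (partition_product n a b) = partition_rank a' + partition_rank b"
      by (simp add: rank_twisting_def partition_monoid_def)
    then show False using no[OF a'(1,2)] by simp
  qed
  then show ?thesis using twisting_rank[OF S] by (simp add: loose_twisting_def)
qed

text \<open>The identity with its first strand cut into two singletons, of rank
  \<open>n - 1\<close>. As a right factor it isolates the lower vertex 1 and keeps all connections
  between the other vertices.\<close>

definition cut :: "nat \<Rightarrow> vertex set set" where
  "cut n = {{Upper 1}, {Lower 1}} \<union> strands ({1..n} - {1})"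

text \<open>If \<open>a c = a\<close> for \<open>c = cut n\<close>, and \<open>1\<close> and \<open>2\<close> are connected in \<open>a\<close>, then they are connected in
  every \<open>a'\<close> with \<open>a' c = a\<close>, while \<open>\<Phi>(a', c) = 0\<close> would require \<open>rank a' = rank a + 1\<close>.\<close>

lemma loose_if_absorbs_cut:
  assumes S: "carrier S \<subseteq> partitions n" "monoid.mult S = partition_product n"
    and a: "a \<in> carrier S" and cut: "cut n \<in> carrier S" and n: "n \<ge> 2"
    and B: "B \<in> a" "Upper 1 \<in> B" "Upper 2 \<in> B" and low: "{Lower 1} \<in> a"
    and rank: "\<And>a' B. a' \<in> carrier S \<Longrightarrow> B \<in> a' \<Longrightarrow> Upper 1 \<in> B \<Longrightarrow> Upper 2 \<in> B \<Longrightarrow>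
      partition_rank a' \<le> partition_rank a"
  shows "loose_twisting S (rank_twisting n)"
proof (rule loose_twistingI[OF S a cut])
  fix a' assume a': "a' \<in> carrier S" "partition_product n a (cut n) = partition_product n a' (cut n)"
  have pa: "a \<in> partitions n" and pc: "cut n \<in> partitions n" and pa': "a' \<in> partitions n"
    using S(1) a cut a'(1) by auto
  have cut_iff: "(m, l) \<in> colourings (cut n) \<longleftrightarrow> (\<forall>i\<in>{1..n} - {1}. m i = l i)" for m l
    by (simp add: cut_def colourings_Un colourings_strands colourings_insert colourings_empty)
  have absorb: "partition_product n a (cut n) = a"
  proof (rule colourings_inject[OF product_in_partitions pa])
    show "colourings (partition_product n a (cut n)) = colourings a"
      unfolding colourings_product[OF pa pc]
    proof (intro equalityI subsetI; clarify)
      fix u l m assume um: "(u, m) \<in> colourings a" and "(m, l) \<in> colourings (cut n)"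
      then have ml: "m i = l i" if "i \<in> {1..n} - {1}" for i using that by (simp add: cut_iff)
      show "(u, l) \<in> colourings a"
        unfolding colourings_def
      proof clarify
        fix C v w assume C: "C \<in> a" "v \<in> C" "w \<in> C"
        show "glue u l v = glue u l w"
        proof (cases "C = {Lower 1}")
          case False
          have "glue u l z = glue u m z" if "z \<in> C" for z
          proof (cases z)
            case (Lower k)
            then have "k \<noteq> 1" using that False block_eq[OF pa C(1) low] by auto
            moreover have "k \<in> {1..n}" using block_subset[OF pa C(1)] that Lower by auto
            ultimately show ?thesis using Lower ml by simp
          qed (simp_all add: glue_def)
          then show ?thesis using colouringsD[OF um C] C by simp
        qed (use C in simp)
      qed
    next
      fix u l assume "(u, l) \<in> colourings a"
      moreover have "(l, l) \<in> colourings (cut n)" by (simp add: cut_iff)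
      ultimately show "(u, l) \<in> colourings a O colourings (cut n)" by blast
    qed
  qed
  obtain C where C: "C \<in> a'" "Upper 1 \<in> C" using block_exists[OF pa', of "Upper 1"] n by auto
  \<comment> \<open>The relation of \<open>cut n\<close> contains the diagonal. Hence every
    colouring of \<open>a'\<close> is one of the product, which is \<open>a\<close>, and what is
    connected in \<open>a\<close> is connected in \<open>a'\<close>.\<close>
  have "Upper 2 \<in> C"
  proof (rule same_blockI[OF pa' C])
    fix u m assume "(u, m) \<in> colourings a'"
    moreover have "(m, m) \<in> colourings (cut n)" by (simp add: cut_iff)
    ultimately have "(u, m) \<in> colourings (partition_product n a' (cut n))"
      unfolding colourings_product[OF pa' pc] by blast
    then have "(u, m) \<in> colourings a" using absorb a'(2) by simp
    then show "glue u m (Upper 1) = glue u m (Upper 2)" by (rule colouringsD[OF _ B])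
  qed (use n in simp)
  then have "partition_rank a' \<le> partition_rank a" by (rule rank[OF a'(1) C])
  moreover have "partition_rank (cut n) = n - 1"
  proof -
    have "partition_rank {{Upper 1}, {Lower 1}} = 0"
      by (simp add: partition_rank_def transversals_insert image_iff)
    then show ?thesis
      using rank_strands[of "{1}" n "{{Upper 1}, {Lower 1}}"] n
      by (simp add: cut_def partition_on_def disjoint_def)
  qed
  ultimately show "n + partition_rank (partition_product n a (cut n)) \<noteq> partition_rank a' + partition_rank (cut n)"
    using n absorb by simp
qed

lemma cut_planar:
  assumes "n \<ge> 2"
  shows "cut n \<in> partial_brauer n \<inter> planar_partitions n"
proof -
  have part: "partition_on (Upper ` {1} \<union> Lower ` {1}) {{Upper 1}, {Lower 1}}"
    by (auto simp: partition_on_def disjoint_def)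
  have "cut n \<in> planar_partitions n"
    unfolding cut_def using assms
  proof (intro planar_strands[OF _ part, of n "{}"] colourings_eqI)
    show "(u, l) \<in> colourings {} \<longleftrightarrow> (u, l) \<in> colourings {{Upper 1}, {Lower 1}}" for u l
      by (simp add: colourings_insert colourings_empty)
  qed auto
  moreover have "card B \<le> 2" if "B \<in> cut n" for B
    using that card_strand[of B "{1..n} - {1}"] by (auto simp: cut_def)
  ultimately show ?thesis by (auto simp: partial_brauer_def planar_partitions_def)
qed

text \<open>The left factor joins 1 and 2 inside a transversal and so attains \<open>n - 1\<close>,
  the largest rank compatible with this connection; a preimage would need rank
  \<open>n\<close>.\<close>

lemma loose_partitions:
  assumes n: "n \<ge> 2" and S: "carrier S \<subseteq> partitions n" "monoid.mult S = partition_product n"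
    and pl: "planar_partitions n \<subseteq> carrier S"
  shows "loose_twisting S (rank_twisting n)"
proof -
  let ?X = "{{Upper 1, Upper 2, Lower 2}, {Lower 1}}"
  let ?a = "?X \<union> strands ({1..n} - {1, 2})"
  have part: "partition_on (Upper ` {1, 2} \<union> Lower ` {1, 2}) ?X"
    by (auto simp: partition_on_def disjoint_def)
  have K: "{1, 2} \<subseteq> {1..n}" using n by auto
  have "transversals ?X = {{Upper 1, Upper 2, Lower 2}}"
    by (simp add: transversals_insert Int_insert_left image_iff)
  then have rank: "partition_rank ?a = n - 1"
    unfolding rank_strands[OF K part] using n by (simp add: partition_rank_def)
  have "?a \<in> planar_partitions n"
  proof (rule planar_strands[OF K part])
    show "{{Upper 1, Upper 2}, {Upper 2, Lower 2}} \<subseteq> ladder n"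
      using n by (auto simp: ladder_def numeral_2_eq_2)
    show "colourings {{Upper 1, Upper 2}, {Upper 2, Lower 2}} = colourings ?X"
      by (rule colourings_eqI) (auto simp: colourings_insert colourings_empty)
  qed
  then have "?a \<in> carrier S" using pl by blast
  moreover have "cut n \<in> carrier S" using cut_planar[OF n] pl by blast
  ultimately show ?thesis
  proof (rule loose_if_absorbs_cut[where B = "{Upper 1, Upper 2, Lower 2}", OF S _ _ n])
    fix a' B assume "a' \<in> carrier S" "B \<in> a'" "Upper 1 \<in> B" "Upper 2 \<in> B"
    then show "partition_rank a' \<le> partition_rank ?a"
      unfolding rank using rank_le_connected(1)[OF _ _ _ _ n] S(1) by blast
  qed auto
qed

text \<open>With blocks of at most two elements, joining 1 and 2 costs two transversals. The left
  factor attains the largest remaining rank \<open>n - 2\<close>, and a preimage would need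
  \<open>n - 1\<close>.\<close>

lemma loose_partial_brauer:
  assumes n: "n \<ge> 2" and S: "carrier S \<subseteq> partial_brauer n" "monoid.mult S = partition_product n"
    and pl: "partial_brauer n \<inter> planar_partitions n \<subseteq> carrier S"
  shows "loose_twisting S (rank_twisting n)"
proof -
  let ?X = "{{Upper 1, Upper 2}, {Lower 1}, {Lower 2}}"
  let ?a = "?X \<union> strands ({1..n} - {1, 2})"
  have Sp: "carrier S \<subseteq> partitions n" using S(1) by (auto simp: partial_brauer_def)
  have part: "partition_on (Upper ` {1, 2} \<union> Lower ` {1, 2}) ?X"
    by (auto simp: partition_on_def disjoint_def)
  have K: "{1, 2} \<subseteq> {1..n}" using n by auto
  have "transversals ?X = {}"
    by (simp add: transversals_insert Int_insert_left image_iff)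
  then have rank: "partition_rank ?a = n - 2"
    unfolding rank_strands[OF K part] using n by (simp add: partition_rank_def)
  have "?a \<in> planar_partitions n"
  proof (rule planar_strands[OF K part])
    show "{{Upper 1, Upper 2}} \<subseteq> ladder n"
      using n by (auto simp: ladder_def numeral_2_eq_2)
    show "colourings {{Upper 1, Upper 2}} = colourings ?X"
      by (rule colourings_eqI) (auto simp: colourings_insert colourings_empty)
  qed
  moreover have "card B \<le> 2" if "B \<in> ?a" for B
    using that card_strand[of B "{1..n} - {1, 2}"] by auto
  ultimately have "?a \<in> carrier S" using pl by (auto simp: partial_brauer_def planar_partitions_def)
  moreover have "cut n \<in> carrier S" using cut_planar[OF n] pl by blast
  ultimately show ?thesis
  proof (rule loose_if_absorbs_cut[where B = "{Upper 1, Upper 2}", OF Sp S(2) _ _ n])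
    fix a' B assume "a' \<in> carrier S" "B \<in> a'" "Upper 1 \<in> B" "Upper 2 \<in> B"
    then show "partition_rank a' \<le> partition_rank ?a"
      unfolding rank using rank_le_connected(2)[OF _ _ _ _ n] S(1) Sp by blast
  qed auto
qed

text \<open>A preimage of full rank would join \<open>{2, 3}\<close> to the hook \<open>{1, 2}\<close> of the right factor, and hence
  \<open>1\<close> to a vertex further right.\<close>

lemma loose_temperley_lieb:
  assumes n: "n \<ge> 3"
  shows "loose_twisting (temperley_lieb_monoid n) (rank_twisting n)"
proof -
  \<comment> \<open>\<open>?b\<close> and \<open>?a\<close> complete these pieces to the adjacent
    Temperley-Lieb generators with hooks on 1, 2 and on 2, 3. Their product \<open>?c\<close> has
    the same rank \<open>n - 2\<close> as \<open>?b\<close>, which is why a preimage would need rank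
    \<open>n\<close>.\<close>
  let ?B = "{{Upper 1, Upper 2}, {Lower 1, Lower 2}}"
  let ?A = "{{Upper 2, Upper 3}, {Lower 2, Lower 3}}"
  let ?C = "{{Upper 2, Upper 3}, {Upper 1, Lower 3}, {Lower 1, Lower 2}}"
  let ?b = "?B \<union> strands ({1..n} - {1, 2})"
  let ?a = "?A \<union> strands ({1..n} - {2, 3})"
  let ?c = "?C \<union> strands ({1..n} - {1, 2, 3})"
  have partB: "partition_on (Upper ` {1, 2} \<union> Lower ` {1, 2}) ?B"
    by (auto simp: partition_on_def disjoint_def)
  have partA: "partition_on (Upper ` {2, 3} \<union> Lower ` {2, 3}) ?A"
    by (auto simp: partition_on_def disjoint_def)
  have partC: "partition_on (Upper ` {1, 2, 3} \<union> Lower ` {1, 2, 3}) ?C"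
    by (auto simp: partition_on_def disjoint_def)
  have KB: "{1, 2} \<subseteq> {1..n}" and KA: "{2, 3} \<subseteq> {1..n}" and KC: "{1, 2, 3} \<subseteq> {1..n}"
    using n by auto
  have pb: "?b \<in> partitions n" and pa: "?a \<in> partitions n" and pc: "?c \<in> partitions n"
    using partition_strands KB KA KC partB partA partC by blast+
  have rank_b: "partition_rank ?b = n - 2"
    unfolding rank_strands[OF KB partB] using n
    by (simp add: partition_rank_def transversals_insert Int_insert_left image_iff)
  have rank_c: "partition_rank ?c = n - 2"
    unfolding rank_strands[OF KC partC] using n
    by (simp add: partition_rank_def transversals_insert Int_insert_left image_iff)
  have lad: "?B \<subseteq> ladder n" "?A \<subseteq> ladder n"
    using n by (auto simp: ladder_def numeral_2_eq_2 numeral_3_eq_3)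
  have "?b \<in> planar_partitions n" "?a \<in> planar_partitions n"
    by (rule planar_strands[OF KB partB lad(1) refl], rule planar_strands[OF KA partA lad(2) refl])
  moreover have "card D = 2" if "D \<in> ?b" for D
    using that card_strand[of D "{1..n} - {1, 2}"] by auto
  moreover have "card D = 2" if "D \<in> ?a" for D
    using that card_strand[of D "{1..n} - {2, 3}"] by auto
  ultimately have b: "?b \<in> brauer n \<inter> planar_partitions n" and a: "?a \<in> brauer n \<inter> planar_partitions n"
    using pa pb by (simp_all add: brauer_def)
  have col_b: "(u, l) \<in> colourings ?b \<longleftrightarrow> u 1 = u 2 \<and> l 1 = l 2 \<and> (\<forall>i\<in>{1..n} - {1, 2}. u i = l i)" for u l
    by (auto simp: colourings_Un colourings_strands colourings_insert colourings_empty)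
  have col_a: "(u, l) \<in> colourings ?a \<longleftrightarrow> u 2 = u 3 \<and> l 2 = l 3 \<and> (\<forall>i\<in>{1..n} - {2, 3}. u i = l i)" for u l
    by (auto simp: colourings_Un colourings_strands colourings_insert colourings_empty)
  have col_c: "(u, l) \<in> colourings ?c \<longleftrightarrow>
      u 2 = u 3 \<and> u 1 = l 3 \<and> l 1 = l 2 \<and> (\<forall>i\<in>{1..n} - {1, 2, 3}. u i = l i)" for u l
    by (auto simp: colourings_Un colourings_strands colourings_insert colourings_empty)
  have ab: "partition_product n ?a ?b = ?c"
  proof (rule colourings_inject[OF product_in_partitions pc colourings_eqI])
    fix u l
    show "(u, l) \<in> colourings (partition_product n ?a ?b) \<longleftrightarrow> (u, l) \<in> colourings ?c"
      unfolding colourings_product[OF pa pb]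
    proof
      assume "(u, l) \<in> colourings ?a O colourings ?b"
      then obtain m where um: "(u, m) \<in> colourings ?a" and ml: "(m, l) \<in> colourings ?b" by blast
      have a: "u 2 = u 3" "m 2 = m 3" "u i = m i" if "i \<in> {1..n} - {2, 3}" for i
        using um that unfolding col_a by auto
      have b: "m 1 = m 2" "l 1 = l 2" "m i = l i" if "i \<in> {1..n} - {1, 2}" for i
        using ml that unfolding col_b by auto
      show "(u, l) \<in> colourings ?c"
        unfolding col_c using a(1,2)[of 1] a(3) b(1,2)[of 3] b(3) n by auto
    next
      assume "(u, l) \<in> colourings ?c"
      then have c: "u 2 = u 3" "u 1 = l 3" "l 1 = l 2" "\<forall>i\<in>{1..n} - {1, 2, 3}. u i = l i"
        unfolding col_c by blast+
      \<comment> \<open>The strand of \<open>?c\<close> from upper 1 to lower 3 runs through all of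
        the middle vertices 1, 2, 3, so these take the colour of lower 3.\<close>
      define m where "m = l(1 := l 3, 2 := l 3)"
      have "(u, m) \<in> colourings ?a" unfolding col_a m_def using c by auto
      moreover have "(m, l) \<in> colourings ?b" unfolding col_b m_def using c by auto
      ultimately show "(u, l) \<in> colourings ?a O colourings ?b" by blast
    qed
  qed
  have S: "carrier (temperley_lieb_monoid n) = brauer n \<inter> planar_partitions n"
    "monoid.mult (temperley_lieb_monoid n) = partition_product n"
    by (simp_all add: temperley_lieb_monoid_def partition_monoid_def)
  show ?thesis
  proof (rule loose_twistingI[OF _ S(2) a[folded S(1)] b[folded S(1)]])
    show "carrier (temperley_lieb_monoid n) \<subseteq> partitions n" by (auto simp: S brauer_def)
    fix a' assume "a' \<in> carrier (temperley_lieb_monoid n)"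
      and a'b: "partition_product n ?a ?b = partition_product n a' ?b"
    then have a': "a' \<in> brauer n" "planar n a'" by (auto simp: S planar_partitions_def)
    then have pa': "a' \<in> partitions n" by (simp add: brauer_def)
    show "n + partition_rank (partition_product n ?a ?b) \<noteq> partition_rank a' + partition_rank ?b"
    proof
      assume "n + partition_rank (partition_product n ?a ?b) = partition_rank a' + partition_rank ?b"
      then have "partition_rank a' = n" using rank_b rank_c ab n by simp
      then have "card {B \<in> a'. B \<subseteq> range Upper} = 0" using rank_count[OF a'(1)] by simp
      then have no_hook: "\<not> B \<subseteq> range Upper" if "B \<in> a'" for B
        using finite_partition[OF pa'] that by auto
      have strand: "\<exists>s\<in>{1..n}. {Upper i, Lower s} \<in> a'" if i: "i \<in> {1..n}" for i
      proof -
        obtain B where B: "B \<in> a'" "Upper i \<in> B" using block_exists[OF pa', of "Upper i"] i by auto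
        then obtain v where v: "v \<in> B" "v \<notin> range Upper" using no_hook by blast
        then have "v \<in> vertices n" using block_subset[OF pa' B(1)] by blast
        then obtain s where s: "v = Lower s" "s \<in> {1..n}" using v(2) by (auto simp: vertices_def)
        have "card B = 2" using a'(1) B(1) by (simp add: brauer_def)
        then have "B = {Upper i, Lower s}"
          using B(2) v(1) s(1) by (auto simp: card_2_iff)
        then show ?thesis using B(1) s(2) by blast
      qed
      obtain s1 s2 s3 where s: "{Upper 1, Lower s1} \<in> a'" "{Upper 2, Lower s2} \<in> a'" "{Upper 3, Lower s3} \<in> a'"
        and s_in: "s1 \<in> {1..n}" "s2 \<in> {1..n}" "s3 \<in> {1..n}"
        using strand[of 1] strand[of 2] strand[of 3] n by auto
      have distinct: "s1 \<noteq> s2" "s1 \<noteq> s3" "s2 \<noteq> s3"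
        using block_eq[OF pa' s(1,2), of "Lower s1"] block_eq[OF pa' s(1,3), of "Lower s1"]
          block_eq[OF pa' s(2,3), of "Lower s2"] by (auto simp: doubleton_eq_iff)
      \<comment> \<open>Suppose the strand of \<open>a'\<close> from 2 or 3 ends at a
        \<open>k\<close> outside the hook of \<open>?b\<close>. Colouring \<open>k\<close> alone
        then passes unchanged through \<open>?b\<close> and separates the upper vertices 2 and 3,
        which form a hook of \<open>?c\<close>.\<close>
      have hook: "k \<in> {1, 2}" if k: "k \<in> {s2, s3}" for k
      proof (rule ccontr)
        assume k12: "k \<notin> {1, 2}"
        obtain i where ik: "{Upper i, Lower k} \<in> a'" using k s by blast
        have only: "j \<in> {k}" if "B \<in> a'" "Lower i \<in> B" "Lower j \<in> B" "i \<in> {k}" for B i j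
          using block_eq[OF pa' that(1) ik, of "Lower i"] that by auto
        obtain u where u: "(u, \<lambda>i. i \<in> {k}) \<in> colourings a'"
          using extend_colouring_upper[OF pa', of "{k}"] only by metis
        moreover have "(\<lambda>i. i \<in> {k}, \<lambda>i. i \<in> {k}) \<in> colourings ?b"
          unfolding col_b using k12 by auto
        ultimately have "(u, \<lambda>i. i \<in> {k}) \<in> colourings (partition_product n a' ?b)"
          unfolding colourings_product[OF pa' pb] by blast
        then have "(u, \<lambda>i. i \<in> {k}) \<in> colourings ?c" using a'b ab by simp
        then have "u 2 = u 3" unfolding col_c by blast
        moreover have "u 2 \<longleftrightarrow> s2 = k" "u 3 \<longleftrightarrow> s3 = k"
          using colouringsD[OF u s(2), of "Upper 2" "Lower s2"]
            colouringsD[OF u s(3), of "Upper 3" "Lower s3"] by auto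
        ultimately show False using k distinct(3) by auto
      qed
      \<comment> \<open>The strands from 2 and 3 occupy the lower vertices 1 and 2. The strand from
        1 must end further right and crosses the strand from 2.\<close>
      have "s2 = 1 \<or> s2 = 2" "s3 = 1 \<or> s3 = 2" using hook[of s2] hook[of s3] by simp_all
      then have "s2 < s1" using distinct s_in(1) by auto
      then show False using planar_no_crossing[OF a'(2) s(1,2)] by simp
    qed
  qed
qed

theorem proposition4p18:
  fixes n :: nat
  assumes "n \<ge> 1"
  shows "tight_twisting (brauer_monoid n) (rank_twisting n) \<and>
    (n \<ge> 2 \<longrightarrow>
       loose_twisting (partition_monoid n) (rank_twisting n) \<and>
       loose_twisting (planar_partition_monoid n) (rank_twisting n) \<and>
       loose_twisting (partial_brauer_monoid n) (rank_twisting n) \<and>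
       loose_twisting (motzkin_monoid n) (rank_twisting n)) \<and>
    (n \<ge> 3 \<longrightarrow>
       loose_twisting (temperley_lieb_monoid n) (rank_twisting n))"
proof (intro conjI impI)
  assume n: "n \<ge> 2"
  show "loose_twisting (partition_monoid n) (rank_twisting n)"
    by (rule loose_partitions[OF n]) (auto simp: partition_monoid_def planar_partitions_def)
  show "loose_twisting (planar_partition_monoid n) (rank_twisting n)"
    by (rule loose_partitions[OF n])
      (auto simp: planar_partition_monoid_def partition_monoid_def planar_partitions_def)
  show "loose_twisting (partial_brauer_monoid n) (rank_twisting n)"
    by (rule loose_partial_brauer[OF n]) (auto simp: partial_brauer_monoid_def partition_monoid_def)
  show "loose_twisting (motzkin_monoid n) (rank_twisting n)"
    by (rule loose_partial_brauer[OF n]) (auto simp: motzkin_monoid_def partition_monoid_def)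
qed (use tight_brauer loose_temperley_lieb in auto)

end
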